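(* Suppose the following hold. (1) $b_j\in\Gamma$ for all $j$, and for every $\alpha\in\Gamma$ and $\varepsilon>0$ there are $p$ and $\rho\in\mathbb{R}^p$ with $\mathrm{E}[\{\alpha(X)-\sum_{j=1}^p\rho_jb_j(X)\}^2]<\varepsilon$. (2) There exist $C>1$, $\xi>0$ such that for each positive integer $s\le C\varepsilon_n^{-2/(2\xi+1)}$ there is $\bar\rho\in\mathbb{R}^p$ with $s$ nonzero elements such that $\Vert\bar\alpha-b'\bar\rho\Vert\le C s^{-\xi}$. (3) $G$ has largest eigenvalue bounded uniformly in $n$, and there are $C,c>0$ such that for all integers $s=s_n\approx C\varepsilon_n^{-2}$ (i.e. $s_n\varepsilon_n^2\to C$), with probability approaching one, $$\min_{J\subset\{1,\dots,p\},\,|J|\le s}\ \min_{\Vert\rho_{J^c}\Vert_1\le 3\Vert\rho_J\Vert_1,\ \rho_J\neq 0}\frac{\rho'\hat G\rho}{\rho_J'\rho_J}\ge c .$$ (4) There is $C>0$ such that with probability one $\sup_j|b_j(X)|\le C$. (5) $\varepsilon_n=o(r)$, $r=o(n^c\varepsilon_n)$ for all $c>0$, and there exists $C>0$ such that $p\le Cn^C$. (6) $\Vert\hat M-M\Vert_\infty=O_p(\varepsilon_n)$ and $\varepsilon_n\to0$. Then for all $c>0$, $$\Vert\hat\alpha-\bar\alpha\Vert=o_p\bigl(n^c\varepsilon_n^{2\xi/(2\xi+1)}\bigr).$$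
   Context: $W_1,\dots,W_n$ are i.i.d. copies of a data observation $W$ that includes a scalar $Y$ with $\mathrm{E}[Y^2]<\infty$ and a covariate vector $X$. $\Gamma$ is a closed linear subspace of the space of functions $\gamma(X)$ with $\mathrm{E}[\gamma(X)^2]<\infty$. $m(w,\gamma)$ is a functional of functions $\gamma$ of $x$, linear in $\gamma$, and there is $\alpha_0(X)$ with $\mathrm{E}[\alpha_0(X)^2]<\infty$ and $\mathrm{E}[m(W,\gamma)]=\mathrm{E}[\alpha_0(X)\gamma(X)]$ for all $\gamma$ with $\mathrm{E}[\gamma(X)^2]<\infty$. $\bar\alpha=\arg\min_{\alpha\in\Gamma}\mathrm{E}[\{\alpha_0(X)-\alpha(X)\}^2]$. $(b_j)_{j\ge1}$ is a sequence of functions of $x$; for each $n$, $b(x)=(b_1(x),\dots,b_p(x))'$ with $p=p_n\ge2$. $G=\mathrm{E}[b(X)b(X)']$, $\hat G=\frac1n\sum_{i=1}^n b(X_i)b(X_i)'$, $M=\mathrm{E}[\bar\alpha(X)b(X)]$ (which equals $\mathrm{E}[m(W,b)]$, with $m(w,b)=(m(w,b_1),\dots,m(w,b_p))'$, when each $b_j\in\Gamma$), and $\hat M$ is an estimator of $M$ (for example $\frac1n\sum_i m(W_i,b)$). With $r=r_n>0$, $$\hat\rho\in\arg\min_{\rho\in\mathbb{R}^p}\{-2\hat M'\rho+\rho'\hat G\rho+2r\Vert\rho\Vert_1\},\qquad \hat\alpha(x)=b(x)'\hat\rho .$$ $\varepsilon_n>0$ is a sequence converging to zero no faster than $\sqrt{\ln(p)/n}$,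 i.e. $\sqrt{\ln(p)/n}=O(\varepsilon_n)$. $\Vert a\Vert=\sqrt{\mathrm{E}[a(W)^2]}$; for an estimated function such as $\hat\alpha$, the expectation is over a $W$ independent of the data with the estimate held fixed, $\Vert\hat\alpha-\bar\alpha\Vert^2=\int\{\hat\alpha(x)-\bar\alpha(x)\}^2F_X(dx)$. $\Vert\cdot\Vert_1$ is the sum and $\Vert\cdot\Vert_\infty$ the maximum of absolute values of the entries. $\rho_J$ is the subvector of $\rho$ with indices in $J$ and $\rho_{J^c}$ the subvector of the remaining components. All limits are as $n\to\infty$. *)

theory Defs
  imports
    "HOL-Probability.Probability"
    "HOL-Library.Landau_Symbols"
    "Jordan_Normal_Form.Spectral_Radius"
begin

(* The notations $ and \<bullet> below are those of the dynamically sized vectors. *)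
unbundle no vec_syntax and no inner_syntax

text \<open>
  P is the law of a generic observation w, and X (with values in N) its covariate part.
  Functions of X are kept as measurable functions on N rather than as
  classes modulo null sets.
\<close>

definition l2_norm :: "'w measure \<Rightarrow> ('w \<Rightarrow> real) \<Rightarrow> real" where
  "l2_norm P a = sqrt (\<integral>w. (a w)\<^sup>2 \<partial>P)"

definition L2_functions ::
    "'w measure \<Rightarrow> ('w \<Rightarrow> 'x) \<Rightarrow> 'x measure \<Rightarrow> ('x \<Rightarrow> real) set" where
  "L2_functions P X N =
     {\<gamma> \<in> borel_measurable N. integrable P (\<lambda>w. (\<gamma> (X w))\<^sup>2)}"

definition closed_linear_subspace ::
    "'w measure \<Rightarrow> ('w \<Rightarrow> 'x) \<Rightarrow> 'x measure \<Rightarrow> ('x \<Rightarrow> real) set \<Rightarrow> bool" where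
  "closed_linear_subspace P X N \<Gamma> \<longleftrightarrow>
     \<Gamma> \<subseteq> L2_functions P X N \<and>
     (\<lambda>x. 0) \<in> \<Gamma> \<and>
     (\<forall>f\<in>\<Gamma>. \<forall>g\<in>\<Gamma>. (\<lambda>x. f x + g x) \<in> \<Gamma>) \<and>
     (\<forall>c. \<forall>f\<in>\<Gamma>. (\<lambda>x. c * f x) \<in> \<Gamma>) \<and>
     (\<forall>F. \<forall>f\<in>L2_functions P X N. (\<forall>k::nat. F k \<in> \<Gamma>) \<longrightarrow>
        (\<lambda>k. l2_norm P (\<lambda>w. F k (X w) - f (X w))) \<longlonglongrightarrow> 0 \<longrightarrow> f \<in> \<Gamma>)"

text \<open>
  Vectors and matrices of dimension k have indices 0, ..., k - 1, so the dictionary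
  functions, numbered from 1 in the usual notation, are numbered from 0 here.
\<close>

definition dict :: "(nat \<Rightarrow> 'x \<Rightarrow> real) \<Rightarrow> nat \<Rightarrow> 'x \<Rightarrow> real vec" where
  "dict b k x = vec k (\<lambda>j. b j x)"

definition gram ::
    "'w measure \<Rightarrow> ('w \<Rightarrow> 'x) \<Rightarrow> (nat \<Rightarrow> 'x \<Rightarrow> real) \<Rightarrow> nat \<Rightarrow> real mat" where
  "gram P X b k = mat k k (\<lambda>(i, j). \<integral>w. b i (X w) * b j (X w) \<partial>P)"

text \<open>The sample of size n consists of W 1, ..., W n.\<close>

definition emp_gram ::
    "(nat \<Rightarrow> 'o \<Rightarrow> 'w) \<Rightarrow> ('w \<Rightarrow> 'x) \<Rightarrow> (nat \<Rightarrow> 'x \<Rightarrow> real) \<Rightarrow>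
     nat \<Rightarrow> nat \<Rightarrow> 'o \<Rightarrow> real mat" where
  "emp_gram W X b k n \<omega> =
     mat k k (\<lambda>(i, j). (1 / real n) *
       (\<Sum>l=1..n. b i (X (W l \<omega>)) * b j (X (W l \<omega>))))"

definition cross_moment ::
    "'w measure \<Rightarrow> ('w \<Rightarrow> 'x) \<Rightarrow> (nat \<Rightarrow> 'x \<Rightarrow> real) \<Rightarrow> ('x \<Rightarrow> real) \<Rightarrow> nat \<Rightarrow> real vec" where
  "cross_moment P X b \<alpha> k = vec k (\<lambda>j. \<integral>w. \<alpha> (X w) * b j (X w) \<partial>P)"

definition l1_norm_on :: "nat set \<Rightarrow> real vec \<Rightarrow> real" where
  "l1_norm_on J v = (\<Sum>j\<in>J. \<bar>v $ j\<bar>)"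

definition l1_norm :: "real vec \<Rightarrow> real" where
  "l1_norm v = l1_norm_on {..<dim_vec v} v"

definition sup_norm :: "real vec \<Rightarrow> real" where
  "sup_norm v = Max ((\<lambda>j. \<bar>v $ j\<bar>) ` {..<dim_vec v})"

definition lasso_objective :: "real vec \<Rightarrow> real mat \<Rightarrow> real \<Rightarrow> real vec \<Rightarrow> real" where
  "lasso_objective M G r \<rho> =
     - 2 * (M \<bullet> \<rho>) + \<rho> \<bullet> (G *\<^sub>v \<rho>) + 2 * r * l1_norm \<rho>"

text \<open>
  The value is extended real so that the infimum over an empty set (for s = 0) is infinite.
\<close>

definition restricted_eigenvalue :: "nat \<Rightarrow> real mat \<Rightarrow> ereal" where
  "restricted_eigenvalue s A =
     (INF J \<in> {J. J \<subseteq> {..<dim_row A} \<and> card J \<le> s}.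
      INF \<rho> \<in> {\<rho> \<in> carrier_vec (dim_row A).
               l1_norm_on ({..<dim_row A} - J) \<rho> \<le> 3 * l1_norm_on J \<rho> \<and> (\<exists>j\<in>J. \<rho> $ j \<noteq> 0)}.
        ereal ((\<rho> \<bullet> (A *\<^sub>v \<rho>)) / (\<Sum>j\<in>J. (\<rho> $ j)\<^sup>2)))"

definition random_vec :: "'o measure \<Rightarrow> nat \<Rightarrow> ('o \<Rightarrow> real vec) \<Rightarrow> bool" where
  "random_vec \<Omega> k V \<longleftrightarrow>
     (\<forall>\<omega>\<in>space \<Omega>. V \<omega> \<in> carrier_vec k) \<and>
     (\<forall>j<k. (\<lambda>\<omega>. V \<omega> $ j) \<in> borel_measurable \<Omega>)"

text \<open>Stochastic orders: Z = O_p(a), Z = o_p(a), and events of probability approaching one.\<close>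

definition bigo_p :: "'o measure \<Rightarrow> (nat \<Rightarrow> 'o \<Rightarrow> real) \<Rightarrow> (nat \<Rightarrow> real) \<Rightarrow> bool" where
  "bigo_p \<Omega> Z a \<longleftrightarrow>
     (\<forall>\<delta>>0. \<exists>B>0. \<forall>\<^sub>F n in sequentially.
        measure \<Omega> {\<omega> \<in> space \<Omega>. \<bar>Z n \<omega>\<bar> > B * a n} < \<delta>)"

definition smallo_p :: "'o measure \<Rightarrow> (nat \<Rightarrow> 'o \<Rightarrow> real) \<Rightarrow> (nat \<Rightarrow> real) \<Rightarrow> bool" where
  "smallo_p \<Omega> Z a \<longleftrightarrow>
     (\<forall>\<delta>>0. (\<lambda>n. measure \<Omega> {\<omega> \<in> space \<Omega>. \<bar>Z n \<omega>\<bar> > \<delta> * a n}) \<longlonglongrightarrow> 0)"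

definition with_prob_approaching_one :: "'o measure \<Rightarrow> (nat \<Rightarrow> 'o \<Rightarrow> bool) \<Rightarrow> bool" where
  "with_prob_approaching_one \<Omega> Q \<longleftrightarrow>
     (\<lambda>n. measure \<Omega> {\<omega> \<in> space \<Omega>. Q n \<omega>}) \<longlonglongrightarrow> 1"

end

theory Submission
  imports Defs
begin

text \<open>
  With E = \<epsilon> powr (-2 / (2 \<xi> + 1)), a sparse approximation with about E terms has squared error of order
  E \<epsilon>^2, but its residual need not be nearly orthogonal to the dictionary. It is replaced by a
  minimiser of the population error plus an l1 penalty of size \<epsilon> off its support. The first order
  conditions bound the inner products of the residual with the dictionary by \<epsilon>, and each new
  coefficient attains this bound, so that Bessel's inequality with the largest eigenvalue of the Gram
  matrix leaves only O(E) of them. The Lasso is compared with this surrogate: its effective noise is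
  O_p(\<epsilon>), hence eventually at most r / 2, and the restricted eigenvalue condition, applied to the
  support enlarged by the other large coordinates of the difference, bounds the full l2 distance of
  the coefficients by a multiple of r sqrt E. The largest eigenvalue turns this into a bound for the
  functions, and r sqrt E = o(n powr c * \<epsilon> powr (2 \<xi> / (2 \<xi> + 1))).
\<close>

subsection \<open>Quadratic forms and the deterministic Lasso inequalities\<close>

text \<open>The effective noise of the Lasso at a coefficient vector y is \<open>M_hat\<close> minus
  the empirical Gram matrix times y. Its population counterpart has the entries
  E[b_j (\<alpha>_bar - b'y)]. For a merely accurate sparse y, Cauchy-Schwarz bounds these only by
  the size of the residual, of order sqrt E * \<epsilon>, which r need not dominate; this is why
  near orthogonality is built into the surrogate. The two Gram matrices are never compared with each
  other. The restricted eigenvalue condition concerns the empirical one and the largest eigenvalue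
  the population one, so the only quantity that can pass from the sample to the population norm is
  the l2 distance of the coefficients. The empirical quadratic form alone would not do. The enlarged
  support is admissible because E = \<epsilon> powr (-2 / (2 \<xi> + 1)) is of smaller order than
  \<epsilon> powr (-2), the sparsity level of the restricted eigenvalue condition. The surrogate
  functions have bounded second moments, but no sup bound uniform in n is established for them, so
  their empirical products with the dictionary call for truncation.\<close>

definition bilin :: "nat \<Rightarrow> (nat \<Rightarrow> nat \<Rightarrow> real) \<Rightarrow> (nat \<Rightarrow> real) \<Rightarrow> (nat \<Rightarrow> real) \<Rightarrow> real" where
  "bilin k A x y = (\<Sum>i<k. \<Sum>j<k. A i j * x i * y j)"

lemma bilin_add_left: "bilin k A (\<lambda>i. x i + y i) z = bilin k A x z + bilin k A y z"
  by (simp add: bilin_def algebra_simps sum.distrib)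

lemma bilin_add_right: "bilin k A z (\<lambda>i. x i + y i) = bilin k A z x + bilin k A z y"
  by (simp add: bilin_def algebra_simps sum.distrib)

lemma bilin_scale_left: "bilin k A (\<lambda>i. c * x i) z = c * bilin k A x z"
  by (simp add: bilin_def sum_distrib_left mult_ac)

lemma bilin_scale_right: "bilin k A z (\<lambda>i. c * x i) = c * bilin k A z x"
  by (simp add: bilin_def sum_distrib_left mult_ac)

lemma bilin_commute:
  assumes "\<And>i j. i < k \<Longrightarrow> j < k \<Longrightarrow> A i j = A j i"
  shows "bilin k A x y = bilin k A y x"
  unfolding bilin_def by (subst sum.swap) (auto intro!: sum.cong simp: assms mult_ac)

lemma bilin_cong:
  assumes "\<And>i. i < k \<Longrightarrow> x i = x' i" "\<And>i. i < k \<Longrightarrow> y i = y' i"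
  shows "bilin k A x y = bilin k A x' y'"
  unfolding bilin_def using assms by (auto intro!: sum.cong)

lemma bilin_indicator_right:
  assumes "j < k"
  shows "bilin k A x (\<lambda>i. if i = j then 1 else 0) = (\<Sum>i<k. A i j * x i)"
  unfolding bilin_def using assms by (simp add: if_distrib cong: if_cong)

text \<open>Tychonoff's theorem for functions on \<open>nat\<close>. With radii that vanish from an
  index k on, the box is a bounded subset of R^k, so coefficient vectors of varying length share one
  type and extrema over them still exist.\<close>

lemma compact_box: "compact {x :: nat \<Rightarrow> real. \<forall>j. \<bar>x j\<bar> \<le> R j}"
proof -
  have "compactin (product_topology (\<lambda>_. euclidean) UNIV) (PiE UNIV (\<lambda>j. {- R j..R j}))"
    by (simp add: compactin_PiE)
  moreover have "PiE UNIV (\<lambda>j. {- R j..R j}) = {x. \<forall>j. \<bar>x j\<bar> \<le> R j}"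
    by (auto simp: PiE_def Pi_def abs_le_iff) (smt (verit))+
  ultimately show ?thesis
    by (simp add: euclidean_product_topology)
qed

lemma continuous_on_coordinate [continuous_intros]:
  "continuous_on S (\<lambda>x :: nat \<Rightarrow> real. x j)"
  by (rule continuous_on_subset[OF continuous_on_product_coordinates]) simp

text \<open>Divide by t and let t tend to 0. All first order conditions below come from this
  one-sided form, which also covers the kinks of the absolute value. The t of the proof is small
  enough for the quadratic term to use up at most half of the negative slope.\<close>

lemma first_order_nonneg:
  fixes a c d :: real
  assumes "d > 0" and "\<And>t. 0 < t \<Longrightarrow> t \<le> d \<Longrightarrow> 0 \<le> t * a + t\<^sup>2 * c"
  shows "0 \<le> a"
proof (rule ccontr)
  assume "\<not> 0 \<le> a"
  define t where "t = min d (- a / (2 * (\<bar>c\<bar> + 1)))"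
  have t: "0 < t" "t \<le> d" using \<open>\<not> 0 \<le> a\<close> \<open>d > 0\<close> 
    by (auto simp: t_def intro!: divide_neg_pos)
  have "t * (\<bar>c\<bar> + 1) \<le> - a / 2"
  proof -
    have "t \<le> - a / (2 * (\<bar>c\<bar> + 1))" by (simp add: t_def)
    then have "t * (2 * (\<bar>c\<bar> + 1)) \<le> - a" by (subst (asm) pos_le_divide_eq) auto
    then show ?thesis by (simp add: algebra_simps)
  qed
  moreover have "t * c \<le> t * (\<bar>c\<bar> + 1)" using t by (intro mult_left_mono) auto
  ultimately have "a + t * c < 0" using \<open>\<not> 0 \<le> a\<close> by linarith
  then have "t * (a + t * c) < 0" using t by (simp add: mult_pos_neg)
  moreover have "t * (a + t * c) = t * a + t\<^sup>2 * c"
    by (simp add: power2_eq_square algebra_simps)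
  ultimately show False using assms(2)[OF t] by linarith
qed

text \<open>Rayleigh's principle: the maximum of the quadratic form on the unit sphere is attained,
  and a maximiser is an eigenvector whose eigenvalue is the maximum. Only the existence of a
  maximiser is needed, no diagonalisation.\<close>

lemma bilin_le_Max_spectrum:
  fixes A :: "real mat"
  assumes A: "A \<in> carrier_mat k k" and "k > 0"
    and sym: "\<And>i j. i < k \<Longrightarrow> j < k \<Longrightarrow> A $$ (i, j) = A $$ (j, i)"
  shows "bilin k (\<lambda>i j. A $$ (i, j)) x x \<le> Max (spectrum A) * (\<Sum>i<k. (x i)\<^sup>2)"
proof -
  let ?q = "\<lambda>x. bilin k (\<lambda>i j. A $$ (i, j)) x x"
  let ?n = "\<lambda>x :: nat \<Rightarrow> real. \<Sum>i<k. (x i)\<^sup>2"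
  \<comment> \<open>The unit sphere of R^k. The coordinate bounds follow from the norm condition for
    j < k and pin the remaining coordinates to 0; they present the sphere as a closed part of a
    compact box.\<close>
  define S where "S = {x :: nat \<Rightarrow> real. \<forall>j. \<bar>x j\<bar> \<le> (if j < k then 1 else 0)} \<inter> {x. ?n x = 1}"
  have "compact S"
    unfolding S_def by (intro compact_Int_closed compact_box closed_Collect_eq continuous_intros)
  moreover have "(\<lambda>i. if i = 0 then 1 else 0) \<in> S"
    using \<open>k > 0\<close> by (auto simp: S_def if_distrib[of "\<lambda>t. t\<^sup>2"] sum.delta cong: if_cong)
  moreover have "continuous_on S ?q"
    unfolding bilin_def by (intro continuous_intros)
  ultimately obtain x0 where x0: "x0 \<in> S" and max: "\<And>y. y \<in> S \<Longrightarrow> ?q y \<le> ?q x0"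
    using continuous_attains_sup[of S ?q] by blast
  define \<mu> where "\<mu> = ?q x0"
  have bound: "?q y \<le> \<mu> * ?n y" for y
  proof (cases "?n y = 0")
    case True
    then have "\<And>i. i < k \<Longrightarrow> y i = 0" by (simp add: sum_nonneg_eq_0_iff)
    then have "?q y = 0" by (simp add: bilin_def)
    then show ?thesis using True by simp
  next
    case False
    then have pos: "?n y > 0" by (metis less_eq_real_def sum_nonneg zero_le_power2)
    define z where "z = (\<lambda>i. if i < k then 1 / sqrt (?n y) * y i else 0)"
    have zn: "?n z = 1"
      using pos by (simp add: z_def power_mult_distrib power_divide flip: sum_divide_distrib)
    have "(z j)\<^sup>2 \<le> 1" if "j < k" for j
      using zn member_le_sum[of j "{..<k}" "\<lambda>i. (z i)\<^sup>2"] that by auto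
    then have "z \<in> S"
      using zn by (auto simp: S_def abs_square_le_1) (simp add: z_def)
    then have "?q z \<le> \<mu>" unfolding \<mu>_def by (rule max)
    moreover have "?q z = ?q (\<lambda>i. 1 / sqrt (?n y) * y i)"
      by (rule bilin_cong) (auto simp: z_def)
    moreover have "\<dots> = ?q y / ?n y"
    proof -
      have "1 / sqrt (?n y) * (1 / sqrt (?n y)) = 1 / ?n y"
        using pos by simp
      then show ?thesis
        unfolding bilin_scale_left bilin_scale_right mult.assoc[symmetric] by simp
    qed
    ultimately have "?q y / ?n y \<le> \<mu>" by (simp only:)
    then show ?thesis using pos by (simp add: pos_divide_le_eq)
  qed
  have n0: "?n x0 = 1" using x0 by (simp add: S_def)
  \<comment> \<open>By homogeneity \<open>bound\<close> holds on the whole space, so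
    \<open>x0\<close> minimises \<mu> |x|^2 minus the form without any constraint, with value 0.
    This replaces a Lagrange multiplier. Testing with both signs of a unit vector then gives the
    eigenvalue equation.\<close>
  have stat: "0 \<le> \<mu> * (\<Sum>i<k. x0 i * y i) - bilin k (\<lambda>i j. A $$ (i, j)) x0 y" for y
  proof -
    have h: "0 \<le> t * (2 * (\<mu> * (\<Sum>i<k. x0 i * y i) - bilin k (\<lambda>i j. A $$ (i, j)) x0 y))
            + t\<^sup>2 * (\<mu> * ?n y - ?q y)" for t
    proof -
      have "?q (\<lambda>i. x0 i + t * y i) = \<mu> + 2 * t * bilin k (\<lambda>i j. A $$ (i, j)) x0 y + t\<^sup>2 * ?q y"
        using bilin_commute[of k "\<lambda>i j. A $$ (i, j)" y x0] sym
        by (simp add: bilin_add_left bilin_add_right bilin_scale_left bilin_scale_right \<mu>_def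
            power2_eq_square)
      moreover have "?n (\<lambda>i. x0 i + t * y i) = ?n x0 + 2 * t * (\<Sum>i<k. x0 i * y i) + t\<^sup>2 * ?n y"
        by (simp add: power2_sum power_mult_distrib sum.distrib sum_distrib_left algebra_simps)
      ultimately show ?thesis
        using bound[of "\<lambda>i. x0 i + t * y i"] n0 by (simp add: algebra_simps)
    qed
    have "0 \<le> 2 * (\<mu> * (\<Sum>i<k. x0 i * y i) - bilin k (\<lambda>i j. A $$ (i, j)) x0 y)"
      by (rule first_order_nonneg[of 1]) (simp, rule h)
    then show ?thesis by simp
  qed
  have eq: "(\<Sum>i<k. A $$ (j, i) * x0 i) = \<mu> * x0 j" if "j < k" for j
  proof -
    let ?e = "\<lambda>i. if i = j then 1 else 0 :: real"
    let ?v = "\<mu> * x0 j - (\<Sum>i<k. A $$ (j, i) * x0 i)"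
    have "(\<Sum>i<k. A $$ (i, j) * x0 i) = (\<Sum>i<k. A $$ (j, i) * x0 i)"
      using that by (intro sum.cong) (simp_all add: sym[of _ j])
    then have b: "bilin k (\<lambda>i j. A $$ (i, j)) x0 ?e = (\<Sum>i<k. A $$ (j, i) * x0 i)"
      using that by (simp add: bilin_indicator_right)
    have s: "(\<Sum>i<k. x0 i * (c * ?e i)) = c * x0 j" for c
      using that by (simp add: if_distrib cong: if_cong)
    have "0 \<le> c * ?v" for c
      using stat[of "\<lambda>i. c * ?e i"] unfolding bilin_scale_right b s by (simp add: algebra_simps)
    from this[of 1] this[of "- 1"] show ?thesis by simp
  qed
  have "eigenvector A (vec k x0) \<mu>"
    unfolding eigenvector_def
  proof (intro conjI)
    show "vec k x0 \<in> carrier_vec (dim_row A)" using A by simp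
    show "vec k x0 \<noteq> 0\<^sub>v (dim_row A)"
    proof
      assume "vec k x0 = 0\<^sub>v (dim_row A)"
      then have "x0 i = 0" if "i < k" for i
        using that A by (metis carrier_matD(1) index_vec index_zero_vec(1))
      then show False using n0 by simp
    qed
    show "A *\<^sub>v vec k x0 = \<mu> \<cdot>\<^sub>v vec k x0"
      using A eq by (intro eq_vecI) (auto simp: scalar_prod_def row_def atLeast0LessThan)
  qed
  then have "\<mu> \<in> spectrum A" by (auto simp: spectrum_def eigenvalue_def)
  then have "\<mu> \<le> Max (spectrum A)"
    using card_finite_spectrum(1)[OF A] by simp
  then show ?thesis
    using bound[of x] by (smt (verit) mult_right_mono sum_nonneg zero_le_power2)
qed

text \<open>Expanding the quadratic part around y leaves a linear term in D. With noise at most r /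
  2 it costs r times the l1 norm of D, while the penalty gains 2 r times the off-support part minus
  the support part. The difference yields the factor 3, the same as in the cone of the restricted
  eigenvalue condition. No true coefficient vector is assumed: y may be any vector vanishing off
  S.\<close>

lemma lasso_basic_inequality:
  fixes m x y :: "nat \<Rightarrow> real"
  assumes sym: "\<And>i j. i < k \<Longrightarrow> j < k \<Longrightarrow> A i j = A j i"
    and S: "S \<subseteq> {..<k}" "\<And>j. j < k \<Longrightarrow> j \<notin> S \<Longrightarrow> y j = 0"
    and noise: "\<And>j. j < k \<Longrightarrow> \<bar>m j - (\<Sum>i<k. A i j * y i)\<bar> \<le> r / 2"
    and opt: "- 2 * (\<Sum>j<k. m j * x j) + bilin k A x x + 2 * r * (\<Sum>j<k. \<bar>x j\<bar>)
           \<le> - 2 * (\<Sum>j<k. m j * y j) + bilin k A y y + 2 * r * (\<Sum>j<k. \<bar>y j\<bar>)"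
    and "r > 0"
  defines "D \<equiv> \<lambda>j. x j - y j"
  shows "bilin k A D D + r * (\<Sum>j\<in>{..<k} - S. \<bar>D j\<bar>) \<le> 3 * r * (\<Sum>j\<in>S. \<bar>D j\<bar>)"
proof -
  have x: "x = (\<lambda>j. y j + D j)" by (simp add: D_def)
  have split: "(\<Sum>j<k. f j) = (\<Sum>j\<in>S. f j) + (\<Sum>j\<in>{..<k} - S. f j)" for f :: "nat \<Rightarrow> real"
    using S(1) by (metis add.commute finite_lessThan sum.subset_diff)
  have yD: "bilin k A y D = (\<Sum>j<k. (\<Sum>i<k. A i j * y i) * D j)"
    unfolding bilin_def by (subst sum.swap) (simp add: sum_distrib_right)
  have "bilin k A x x = bilin k A y y + 2 * bilin k A y D + bilin k A D D"
    unfolding x using bilin_commute[of k A D y] sym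
    by (simp add: bilin_add_left bilin_add_right)
  moreover have "(\<Sum>j<k. m j * x j) = (\<Sum>j<k. m j * y j) + (\<Sum>j<k. m j * D j)"
    unfolding x by (simp add: algebra_simps sum.distrib)
  ultimately have 1: "bilin k A D D + 2 * r * ((\<Sum>j<k. \<bar>x j\<bar>) - (\<Sum>j<k. \<bar>y j\<bar>))
      \<le> 2 * (\<Sum>j<k. (m j - (\<Sum>i<k. A i j * y i)) * D j)"
    using opt by (simp add: yD sum_subtractf algebra_simps)
  have 2: "(\<Sum>j<k. (m j - (\<Sum>i<k. A i j * y i)) * D j) \<le> (\<Sum>j<k. r / 2 * \<bar>D j\<bar>)"
  proof (rule sum_mono)
    fix j assume "j \<in> {..<k}"
    then have "\<bar>m j - (\<Sum>i<k. A i j * y i)\<bar> * \<bar>D j\<bar> \<le> r / 2 * \<bar>D j\<bar>"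
      using noise by (intro mult_right_mono) auto
    then show "(m j - (\<Sum>i<k. A i j * y i)) * D j \<le> r / 2 * \<bar>D j\<bar>"
      by (metis abs_le_D1 abs_mult)
  qed
  have "(\<Sum>j\<in>S. \<bar>y j\<bar>) \<le> (\<Sum>j\<in>S. \<bar>x j\<bar> + \<bar>D j\<bar>)"
    by (rule sum_mono) (auto simp: D_def)
  moreover have "(\<Sum>j\<in>{..<k} - S. \<bar>y j\<bar>) = 0" "(\<Sum>j\<in>{..<k} - S. \<bar>x j\<bar>) = (\<Sum>j\<in>{..<k} - S. \<bar>D j\<bar>)"
    using S(2) by (auto simp: D_def)
  ultimately have "(\<Sum>j\<in>{..<k} - S. \<bar>D j\<bar>) - (\<Sum>j\<in>S. \<bar>D j\<bar>) \<le> (\<Sum>j<k. \<bar>x j\<bar>) - (\<Sum>j<k. \<bar>y j\<bar>)"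
    by (simp add: split[of "\<lambda>j. \<bar>x j\<bar>"] split[of "\<lambda>j. \<bar>y j\<bar>"] sum.distrib)
  then have "2 * r * ((\<Sum>j\<in>{..<k} - S. \<bar>D j\<bar>) - (\<Sum>j\<in>S. \<bar>D j\<bar>))
      \<le> 2 * r * ((\<Sum>j<k. \<bar>x j\<bar>) - (\<Sum>j<k. \<bar>y j\<bar>))"
    using \<open>r > 0\<close> by (intro mult_left_mono) auto
  with 1 2 have "bilin k A D D + 2 * r * ((\<Sum>j\<in>{..<k} - S. \<bar>D j\<bar>) - (\<Sum>j\<in>S. \<bar>D j\<bar>))
      \<le> r * (\<Sum>j<k. \<bar>D j\<bar>)"
    unfolding sum_distrib_left[symmetric] by simp
  then show ?thesis
    by (simp add: split[of "\<lambda>j. \<bar>D j\<bar>"] algebra_simps)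
qed

lemma sum_abs_power2_le:
  fixes f :: "'a \<Rightarrow> real"
  assumes "real (card S) \<le> c"
  shows "(\<Sum>j\<in>S. \<bar>f j\<bar>)\<^sup>2 \<le> c * (\<Sum>j\<in>S. (f j)\<^sup>2)"
proof -
  have "(\<Sum>j\<in>S. \<bar>f j\<bar> * 1)\<^sup>2 \<le> (\<Sum>j\<in>S. \<bar>f j\<bar>\<^sup>2) * (\<Sum>j\<in>S. 1\<^sup>2)"
    by (rule Cauchy_Schwarz_ineq_sum)
  also have "\<dots> = real (card S) * (\<Sum>j\<in>S. (f j)\<^sup>2)" by simp
  also have "\<dots> \<le> c * (\<Sum>j\<in>S. (f j)\<^sup>2)"
    using assms by (intro mult_right_mono sum_nonneg) auto
  finally show ?thesis by simp
qed

text \<open>The restricted eigenvalue sees only the coordinates in J. The others are controlled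
  because each is at most \<tau> in size and their l1 norm is at most b. The factor 90 is 9 from the
  coordinates in J times 10 = 1 + 9 for adding the tail.\<close>

lemma lasso_l2_bound:
  fixes D :: "nat \<Rightarrow> real"
  assumes S: "S \<subseteq> {..<k}" "card S \<le> n" and "n \<ge> 1" "2 * n \<le> s"
    and psd: "0 \<le> bilin k A D D"
    and cone: "bilin k A D D + r * (\<Sum>j\<in>{..<k} - S. \<bar>D j\<bar>) \<le> 3 * r * (\<Sum>j\<in>S. \<bar>D j\<bar>)"
    and RE: "\<And>J. \<lbrakk>J \<subseteq> {..<k}; card J \<le> s;
              (\<Sum>j\<in>{..<k} - J. \<bar>D j\<bar>) \<le> 3 * (\<Sum>j\<in>J. \<bar>D j\<bar>)\<rbrakk> \<Longrightarrow>
             c * (\<Sum>j\<in>J. (D j)\<^sup>2) \<le> bilin k A D D"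
    and "c > 0" "r > 0"
  shows "(\<Sum>j<k. (D j)\<^sup>2) \<le> 90 * r\<^sup>2 * real n / c\<^sup>2"
proof -
  have fS: "finite S" using S(1) finite_subset by blast
  define b where "b = (\<Sum>j\<in>{..<k} - S. \<bar>D j\<bar>)"
  define a where "a = (\<Sum>j\<in>S. \<bar>D j\<bar>)"
  \<comment> \<open>The off-support mass spread evenly over n slots: at most n coordinates can
    exceed it, so J has at most 2 n elements, and the tail costs \<tau> * b = b^2 / n, which is of
    the order of \<open>T\<close>.\<close>
  define \<tau> where "\<tau> = b / real n"
  define J1 where "J1 = {j \<in> {..<k} - S. \<bar>D j\<bar> > \<tau>}"
  define J where "J = S \<union> J1"
  have b0: "b \<ge> 0" by (simp add: b_def sum_nonneg)
  have "r * b \<le> r * (3 * a)" using cone psd by (simp add: a_def b_def mult_ac)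
  then have ba: "b \<le> 3 * a" using \<open>r > 0\<close> by simp
  have "card J1 \<le> n"
  proof (cases "b = 0")
    case True
    then have "D j = 0" if "j \<in> {..<k} - S" for j
      using that by (simp add: b_def sum_nonneg_eq_0_iff)
    then have "J1 = {}" by (auto simp: J1_def \<tau>_def True)
    then show ?thesis by simp
  next
    case False
    then have "\<tau> > 0" using b0 \<open>n \<ge> 1\<close> by (simp add: \<tau>_def)
    have "\<tau> * real (card J1) = (\<Sum>j\<in>J1. \<tau>)" by simp
    also have "\<dots> \<le> (\<Sum>j\<in>J1. \<bar>D j\<bar>)" by (rule sum_mono) (auto simp: J1_def)
    also have "\<dots> \<le> b" unfolding b_def by (rule sum_mono2) (auto simp: J1_def)
    also have "b = \<tau> * real n" using \<open>n \<ge> 1\<close> by (simp add: \<tau>_def)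
    finally show ?thesis using \<open>\<tau> > 0\<close> by simp
  qed
  then have cJ: "card J \<le> s"
    using S(2) \<open>2 * n \<le> s\<close> card_Un_le[of S J1] by (simp add: J_def)
  have J: "J \<subseteq> {..<k}" "finite J" using S(1) fS by (auto simp: J_def J1_def)
  have Jb: "(\<Sum>j\<in>{..<k} - J. \<bar>D j\<bar>) \<le> b"
    unfolding b_def by (rule sum_mono2) (auto simp: J_def)
  have "a \<le> (\<Sum>j\<in>J. \<bar>D j\<bar>)"
    unfolding a_def using J by (intro sum_mono2) (auto simp: J_def)
  with Jb have "(\<Sum>j\<in>{..<k} - J. \<bar>D j\<bar>) \<le> 3 * (\<Sum>j\<in>J. \<bar>D j\<bar>)" using ba by linarith
  then have RE_J: "c * (\<Sum>j\<in>J. (D j)\<^sup>2) \<le> bilin k A D D" by (rule RE[OF J(1) cJ])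
  define T where "T = (\<Sum>j\<in>J. (D j)\<^sup>2)"
  have T0: "T \<ge> 0" by (simp add: T_def sum_nonneg)
  have "a\<^sup>2 \<le> real n * (\<Sum>j\<in>S. (D j)\<^sup>2)"
    unfolding a_def using S(2) by (intro sum_abs_power2_le) simp
  also have "(\<Sum>j\<in>S. (D j)\<^sup>2) \<le> T"
    unfolding T_def using J by (intro sum_mono2) (auto simp: J_def)
  finally have aT: "a\<^sup>2 \<le> real n * T" by (simp add: mult_left_mono)
  \<comment> \<open>The form is at most 3 r a, and a^2 is at most n * T. Squaring therefore leaves
    one surplus factor T, which cancels.\<close>
  have "c * T \<le> 3 * r * a"
    using RE_J cone mult_nonneg_nonneg[of r b] b0 \<open>r > 0\<close>
    unfolding T_def a_def[symmetric] b_def[symmetric] by linarith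
  then have "(c * T)\<^sup>2 \<le> (3 * r * a)\<^sup>2"
    using T0 \<open>c > 0\<close> by (intro power_mono) auto
  also have "\<dots> = 9 * r\<^sup>2 * a\<^sup>2" by (simp add: power_mult_distrib)
  also have "\<dots> \<le> 9 * r\<^sup>2 * (real n * T)" using aT by (intro mult_left_mono) auto
  finally have "(c\<^sup>2 * T) * T \<le> (9 * r\<^sup>2 * real n) * T"
    by (simp add: power2_eq_square mult_ac)
  then have "T \<le> 9 * r\<^sup>2 * real n / c\<^sup>2"
    using T0 \<open>c > 0\<close> \<open>r > 0\<close>
    by (cases "T = 0") (auto simp: field_simps)
  have "(\<Sum>j\<in>{..<k} - J. (D j)\<^sup>2) \<le> (\<Sum>j\<in>{..<k} - J. \<tau> * \<bar>D j\<bar>)"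
  proof (rule sum_mono)
    fix j assume "j \<in> {..<k} - J"
    then have "\<bar>D j\<bar> \<le> \<tau>" by (auto simp: J_def J1_def)
    then have "\<bar>D j\<bar> * \<bar>D j\<bar> \<le> \<tau> * \<bar>D j\<bar>" by (intro mult_right_mono) auto
    then show "(D j)\<^sup>2 \<le> \<tau> * \<bar>D j\<bar>" by (simp add: power2_eq_square)
  qed
  also have "\<dots> \<le> \<tau> * b"
    using Jb b0 unfolding sum_distrib_left[symmetric]
    by (intro mult_left_mono) (auto simp: \<tau>_def)
  also have "\<dots> = b\<^sup>2 / real n" by (simp add: \<tau>_def power2_eq_square)
  also have "\<dots> \<le> 9 * T"
  proof -
    have "b\<^sup>2 \<le> (3 * a)\<^sup>2" using ba b0 by (intro power_mono) auto
    also have "\<dots> \<le> 9 * (real n * T)" using aT by (simp add: power_mult_distrib)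
    finally show ?thesis using \<open>n \<ge> 1\<close> by (simp add: field_simps)
  qed
  finally have "(\<Sum>j\<in>{..<k} - J. (D j)\<^sup>2) \<le> 9 * T" .
  moreover have "(\<Sum>j<k. (D j)\<^sup>2) = T + (\<Sum>j\<in>{..<k} - J. (D j)\<^sup>2)"
    unfolding T_def using J(1) by (metis add.commute finite_lessThan sum.subset_diff)
  ultimately have "(\<Sum>j<k. (D j)\<^sup>2) \<le> 10 * T" by simp
  then show ?thesis using \<open>T \<le> _\<close> by simp
qed

subsection \<open>Sparse surrogates in the population\<close>

definition sq_int :: "'a measure \<Rightarrow> ('a \<Rightarrow> real) \<Rightarrow> bool" where
  "sq_int M f \<longleftrightarrow> f \<in> borel_measurable M \<and> integrable M (\<lambda>x. (f x)\<^sup>2)"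

lemma sq_int_mult:
  assumes "sq_int M f" "sq_int M g"
  shows "integrable M (\<lambda>x. f x * g x)"
proof (rule Bochner_Integration.integrable_bound)
  show "integrable M (\<lambda>x. (f x)\<^sup>2 + (g x)\<^sup>2)" using assms by (auto simp: sq_int_def)
  show "(\<lambda>x. f x * g x) \<in> borel_measurable M" using assms by (auto simp: sq_int_def)
  have "\<bar>u * v\<bar> \<le> u\<^sup>2 + v\<^sup>2" for u v :: real
    using sum_squares_bound[of "\<bar>u\<bar>" "\<bar>v\<bar>"] mult_nonneg_nonneg[of "\<bar>u\<bar>" "\<bar>v\<bar>"]
    unfolding abs_mult power2_abs by linarith
  then show "AE x in M. norm (f x * g x) \<le> norm ((f x)\<^sup>2 + (g x)\<^sup>2)" by auto
qed

lemma sq_int_add: "sq_int M f \<Longrightarrow> sq_int M g \<Longrightarrow> sq_int M (\<lambda>x. f x + g x)"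
  using sq_int_mult[of M f g] by (auto simp: sq_int_def power2_sum mult.assoc)

lemma sq_int_scale: "sq_int M f \<Longrightarrow> sq_int M (\<lambda>x. c * f x)"
  by (auto simp: sq_int_def power_mult_distrib)

lemma sq_int_diff: "sq_int M f \<Longrightarrow> sq_int M g \<Longrightarrow> sq_int M (\<lambda>x. f x - g x)"
  using sq_int_add[of M f "\<lambda>x. (- 1) * g x"] sq_int_scale[of M g "- 1"] by simp

lemma sq_int_sum:
  assumes "\<And>j. j \<in> I \<Longrightarrow> sq_int M (f j)"
  shows "sq_int M (\<lambda>x. \<Sum>j\<in>I. c j * f j x)"
  using assms
proof (induction I rule: infinite_finite_induct)
  case (insert j I)
  then show ?case by (simp add: sq_int_add sq_int_scale)
qed (simp_all add: sq_int_def)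

lemma integral_sq_sub_scale:
  assumes "sq_int M e" "sq_int M h"
  shows "(\<integral>w. (e w - t * h w)\<^sup>2 \<partial>M)
    = (\<integral>w. (e w)\<^sup>2 \<partial>M) - 2 * t * (\<integral>w. h w * e w \<partial>M) + t\<^sup>2 * (\<integral>w. (h w)\<^sup>2 \<partial>M)"
proof -
  have "(\<lambda>w. (e w - t * h w)\<^sup>2) = (\<lambda>w. (e w)\<^sup>2 - 2 * t * (h w * e w) + t\<^sup>2 * (h w)\<^sup>2)"
    by (simp add: power2_diff power_mult_distrib algebra_simps)
  then show ?thesis
    using assms sq_int_mult[OF assms(2,1)] by (simp add: sq_int_def)
qed

lemma integral_sq_add_le:
  assumes "sq_int M f" "sq_int M g"
  shows "(\<integral>w. (f w + g w)\<^sup>2 \<partial>M) \<le> 2 * (\<integral>w. (f w)\<^sup>2 \<partial>M) + 2 * (\<integral>w. (g w)\<^sup>2 \<partial>M)"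
proof -
  have "(\<integral>w. (f w + g w)\<^sup>2 \<partial>M) \<le> (\<integral>w. 2 * (f w)\<^sup>2 + 2 * (g w)\<^sup>2 \<partial>M)"
  proof (rule integral_mono)
    show "integrable M (\<lambda>w. (f w + g w)\<^sup>2)" using sq_int_add[OF assms] by (simp add: sq_int_def)
    show "(f w + g w)\<^sup>2 \<le> 2 * (f w)\<^sup>2 + 2 * (g w)\<^sup>2" for w
      using sum_squares_bound[of "f w" "g w"] by (simp add: power2_sum)
  qed (use assms in \<open>auto simp: sq_int_def\<close>)
  then show ?thesis using assms by (simp add: sq_int_def)
qed

lemma integral_lincomb_mult:
  assumes "\<And>j. j < k \<Longrightarrow> sq_int M (f j)" "sq_int M a"
  shows "(\<integral>w. (\<Sum>j<k. x j * f j w) * a w \<partial>M) = (\<Sum>j<k. x j * (\<integral>w. f j w * a w \<partial>M))"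
proof -
  have "(\<integral>w. (\<Sum>j<k. x j * f j w) * a w \<partial>M) = (\<integral>w. (\<Sum>j<k. x j * (f j w * a w)) \<partial>M)"
    by (simp add: sum_distrib_right mult.assoc)
  also have "\<dots> = (\<Sum>j<k. x j * (\<integral>w. f j w * a w \<partial>M))"
    using assms sq_int_mult by (subst Bochner_Integration.integral_sum) auto
  finally show ?thesis .
qed

lemma integral_lincomb_sq:
  assumes "\<And>j. j < k \<Longrightarrow> sq_int M (f j)"
  shows "(\<integral>w. (\<Sum>j<k. x j * f j w)\<^sup>2 \<partial>M) = bilin k (\<lambda>i j. \<integral>w. f i w * f j w \<partial>M) x x"
proof -
  have L: "sq_int M (\<lambda>w. \<Sum>j<k. x j * f j w)" using assms by (intro sq_int_sum) auto
  have "(\<integral>w. (\<Sum>j<k. x j * f j w)\<^sup>2 \<partial>M) = (\<Sum>i<k. x i * (\<integral>w. f i w * (\<Sum>j<k. x j * f j w) \<partial>M))"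
    using integral_lincomb_mult[OF assms L] by (simp add: power2_eq_square)
  also have "\<dots> = (\<Sum>i<k. x i * (\<Sum>j<k. x j * (\<integral>w. f j w * f i w \<partial>M)))"
  proof (rule sum.cong[OF refl])
    fix i assume "i \<in> {..<k}"
    then have "(\<integral>w. (\<Sum>j<k. x j * f j w) * f i w \<partial>M) = (\<Sum>j<k. x j * (\<integral>w. f j w * f i w \<partial>M))"
      using assms by (intro integral_lincomb_mult) auto
    then show "x i * (\<integral>w. f i w * (\<Sum>j<k. x j * f j w) \<partial>M)
        = x i * (\<Sum>j<k. x j * (\<integral>w. f j w * f i w \<partial>M))"
      by (simp only: mult.commute[of "f i _"])
  qed
  also have "\<dots> = bilin k (\<lambda>i j. \<integral>w. f i w * f j w \<partial>M) x x"
    unfolding bilin_def by (simp add: sum_distrib_left mult_ac)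
  finally show ?thesis .
qed

text \<open>The Gram matrix may be singular, so coercivity has to come from the penalty; hence every
  weight must be positive. If some |y j| exceeds \<open>R j\<close>, the penalty of that coordinate
  alone is larger than the value of F at 0, so the search can be restricted to a box.\<close>

lemma weighted_l1_minimizer_exists:
  fixes f :: "nat \<Rightarrow> 'a \<Rightarrow> real"
  assumes f: "\<And>j. j < k \<Longrightarrow> sq_int M (f j)" and a: "sq_int M a"
    and v: "\<And>j. j < k \<Longrightarrow> v j > 0"
  defines "F \<equiv> \<lambda>x. (\<integral>w. (a w - (\<Sum>j<k. x j * f j w))\<^sup>2 \<partial>M) + 2 * (\<Sum>j<k. v j * \<bar>x j\<bar>)"
  shows "\<exists>x. \<forall>y. F x \<le> F y"
proof -
  have F_eq: "F x = (\<integral>w. (a w)\<^sup>2 \<partial>M) - 2 * (\<Sum>j<k. x j * (\<integral>w. f j w * a w \<partial>M))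
      + bilin k (\<lambda>i j. \<integral>w. f i w * f j w \<partial>M) x x + 2 * (\<Sum>j<k. v j * \<bar>x j\<bar>)" for x
    using integral_sq_sub_scale[OF a sq_int_sum[of "{..<k}" M f x], of 1] f a
    by (simp add: F_def integral_lincomb_mult integral_lincomb_sq)
  have cont: "continuous_on S F" for S
    unfolding F_eq[abs_def] bilin_def by (intro continuous_intros)
  define R where "R j = (if j < k then (\<integral>w. (a w)\<^sup>2 \<partial>M) / (2 * v j) else 0)" for j
  define S where "S = {x :: nat \<Rightarrow> real. \<forall>j. \<bar>x j\<bar> \<le> R j}"
  have R0: "R j \<ge> 0" for j
    using v[of j] by (auto simp: R_def intro!: divide_nonneg_pos integral_nonneg_AE)
  have "compact S" unfolding S_def by (rule compact_box)
  moreover have zS: "(\<lambda>_. 0) \<in> S" using R0 by (simp add: S_def)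
  ultimately obtain x where x: "x \<in> S" "\<And>y. y \<in> S \<Longrightarrow> F x \<le> F y"
    using continuous_attains_inf[of S F] cont by blast
  have "F x \<le> F y" for y
  proof (cases "\<forall>j<k. \<bar>y j\<bar> \<le> R j")
    case True
    let ?y = "\<lambda>j. if j < k then y j else 0"
    have "?y \<in> S" using True by (auto simp: S_def R_def)
    then have "F x \<le> F ?y" by (rule x)
    also have "F ?y = F y"
    proof -
      have "(\<Sum>j<k. ?y j * f j w) = (\<Sum>j<k. y j * f j w)" for w by (rule sum.cong) auto
      moreover have "(\<Sum>j<k. v j * \<bar>?y j\<bar>) = (\<Sum>j<k. v j * \<bar>y j\<bar>)" by (rule sum.cong) auto
      ultimately show ?thesis by (simp only: F_def)
    qed
    finally show ?thesis .
  next
    case False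
    then obtain j where j: "j < k" "\<bar>y j\<bar> > R j" by auto
    have "F x \<le> F (\<lambda>_. 0)" using zS by (rule x)
    also have "\<dots> = (\<integral>w. (a w)\<^sup>2 \<partial>M)" by (simp add: F_def)
    also have "\<dots> = 2 * (v j * R j)" using j v[OF j(1)] by (simp add: R_def)
    also have "\<dots> \<le> 2 * (v j * \<bar>y j\<bar>)" using j v[OF j(1)] by simp
    also have "v j * \<bar>y j\<bar> \<le> (\<Sum>j<k. v j * \<bar>y j\<bar>)"
      using j v by (intro member_le_sum) (auto simp: less_imp_le)
    also have "2 * \<dots> \<le> F y" by (auto simp: F_def intro!: integral_nonneg_AE)
    finally show ?thesis by simp
  qed
  then show ?thesis by blast
qed

text \<open>One coordinate is moved by t in either direction. At a zero coordinate the penalty has a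
  kink and only the bound survives; at a nonzero one it is differentiable, and the two directions
  together force equality.\<close>

lemma weighted_l1_minimizer_KKT:
  fixes f :: "nat \<Rightarrow> 'a \<Rightarrow> real"
  assumes f: "\<And>j. j < k \<Longrightarrow> sq_int M (f j)" and a: "sq_int M a"
    and min: "\<And>y. (\<integral>w. (a w - (\<Sum>j<k. x j * f j w))\<^sup>2 \<partial>M) + 2 * (\<Sum>j<k. v j * \<bar>x j\<bar>)
       \<le> (\<integral>w. (a w - (\<Sum>j<k. y j * f j w))\<^sup>2 \<partial>M) + 2 * (\<Sum>j<k. v j * \<bar>y j\<bar>)"
    and v: "v j \<ge> 0" and j: "j < k"
  defines "g \<equiv> (\<integral>w. f j w * (a w - (\<Sum>j<k. x j * f j w)) \<partial>M)"
  shows "\<bar>g\<bar> \<le> v j" and "x j \<noteq> 0 \<Longrightarrow> \<bar>g\<bar> = v j"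
proof -
  let ?e = "\<lambda>w. a w - (\<Sum>j<k. x j * f j w)"
  define H where "H = (\<integral>w. (f j w)\<^sup>2 \<partial>M)"
  have e: "sq_int M ?e" using a f by (intro sq_int_diff sq_int_sum) auto
  have var: "0 \<le> - 2 * t * g + t\<^sup>2 * H + 2 * v j * (\<bar>x j + t\<bar> - \<bar>x j\<bar>)" for t
  proof -
    let ?y = "x(j := x j + t)"
    have "(\<Sum>i<k. ?y i * f i w) = (\<Sum>i<k. x i * f i w) + t * f j w" for w
      using j by (simp add: sum.remove[of "{..<k}" j] algebra_simps)
    then have "(\<integral>w. (a w - (\<Sum>i<k. ?y i * f i w))\<^sup>2 \<partial>M) = (\<integral>w. (?e w - t * f j w)\<^sup>2 \<partial>M)"
      by (simp add: algebra_simps)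
    also have "\<dots> = (\<integral>w. (?e w)\<^sup>2 \<partial>M) - 2 * t * g + t\<^sup>2 * H"
      unfolding g_def H_def by (rule integral_sq_sub_scale[OF e f[OF j]])
    finally have "(\<integral>w. (a w - (\<Sum>i<k. ?y i * f i w))\<^sup>2 \<partial>M) = (\<integral>w. (?e w)\<^sup>2 \<partial>M) - 2 * t * g + t\<^sup>2 * H" .
    moreover have "(\<Sum>i<k. v i * \<bar>?y i\<bar>) = (\<Sum>i<k. v i * \<bar>x i\<bar>) + v j * (\<bar>x j + t\<bar> - \<bar>x j\<bar>)"
      using j by (simp add: sum.remove[of "{..<k}" j] algebra_simps)
    ultimately show ?thesis using min[of ?y] by simp
  qed
  \<comment> \<open>Here s is the direction of the move and u an upper bound for the slope of the
    penalty over the range d. Slope 1 is always valid by the triangle inequality; moving towards 0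
    gives slope -1 as long as t is at most |x j|.\<close>
  have side: "0 \<le> s * (- 2 * g) + 2 * v j * u"
    if s: "\<bar>s\<bar> = 1" and d: "d > 0" and u: "\<And>t. 0 < t \<Longrightarrow> t \<le> d \<Longrightarrow> \<bar>x j + s * t\<bar> - \<bar>x j\<bar> \<le> t * u"
    for s u d
  proof (rule first_order_nonneg[OF d, where c = H])
    fix t :: real assume t: "0 < t" "t \<le> d"
    have "v j * (\<bar>x j + s * t\<bar> - \<bar>x j\<bar>) \<le> v j * (t * u)"
      using u[OF t] v by (rule mult_left_mono)
    moreover have "s\<^sup>2 = 1" using s by (metis power2_abs power_one)
    ultimately show "0 \<le> t * (s * (- 2 * g) + 2 * v j * u) + t\<^sup>2 * H"
      using var[of "s * t"] by (simp add: power_mult_distrib algebra_simps)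
  qed
  show le: "\<bar>g\<bar> \<le> v j"
  proof (rule abs_leI)
    show "g \<le> v j" using side[of 1 1 1] abs_triangle_ineq[of "x j"] by force
    show "- g \<le> v j" using side[of "- 1" 1 1] abs_triangle_ineq4[of "x j"] by force
  qed
  show "\<bar>g\<bar> = v j" if "x j \<noteq> 0"
  proof (cases "x j > 0")
    case True
    have "0 \<le> 1 * (- 2 * g) + 2 * v j * 1" using True by (intro side[where d = "x j"]) auto
    moreover have "0 \<le> (- 1) * (- 2 * g) + 2 * v j * (- 1)" using True by (intro side[where d = "x j"]) auto
    ultimately show ?thesis using le v by auto
  next
    case False
    have "0 \<le> 1 * (- 2 * g) + 2 * v j * (- 1)" using False that by (intro side[where d = "- x j"]) auto
    moreover have "0 \<le> (- 1) * (- 2 * g) + 2 * v j * 1" using False that by (intro side[where d = "- x j"]) auto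
    ultimately show ?thesis using le v by auto
  qed
qed

text \<open>The synthesis map x \<mapsto> sum of x j * f j has squared norm at most L, hence so has
  its adjoint, which takes e to its inner products with the f j. Concretely, the residual of e after
  subtracting 1 / L times the synthesis of these inner products has nonnegative square; 1 / L is the
  best step that the upper bound permits.\<close>

lemma bessel_upper_bound:
  fixes f :: "nat \<Rightarrow> 'a \<Rightarrow> real"
  assumes f: "\<And>j. j < k \<Longrightarrow> sq_int M (f j)" and e: "sq_int M e"
    and upper: "\<And>x. (\<integral>w. (\<Sum>j<k. x j * f j w)\<^sup>2 \<partial>M) \<le> L * (\<Sum>j<k. (x j)\<^sup>2)"
    and "L > 0" and T: "T \<subseteq> {..<k}"
  shows "(\<Sum>j\<in>T. (\<integral>w. f j w * e w \<partial>M)\<^sup>2) \<le> L * (\<integral>w. (e w)\<^sup>2 \<partial>M)"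
proof -
  define g where "g j = (if j \<in> T then (\<integral>w. f j w * e w \<partial>M) else 0)" for j
  define s where "s = (\<Sum>j\<in>T. (\<integral>w. f j w * e w \<partial>M)\<^sup>2)"
  have s: "(\<Sum>j<k. (g j)\<^sup>2) = s" "(\<Sum>j<k. g j * (\<integral>w. f j w * e w \<partial>M)) = s"
    using T by (auto simp: s_def g_def power2_eq_square intro!: sum.mono_neutral_cong_right)
  have "0 \<le> (\<integral>w. (e w - 1 / L * (\<Sum>j<k. g j * f j w))\<^sup>2 \<partial>M)" by simp
  also have "\<dots> = (\<integral>w. (e w)\<^sup>2 \<partial>M) - 2 * (1 / L) * s + (1 / L)\<^sup>2 * (\<integral>w. (\<Sum>j<k. g j * f j w)\<^sup>2 \<partial>M)"
    using f e s(2) by (subst integral_sq_sub_scale) (auto intro!: sq_int_sum simp: integral_lincomb_mult)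
  also have "\<dots> \<le> (\<integral>w. (e w)\<^sup>2 \<partial>M) - 2 * (1 / L) * s + (1 / L)\<^sup>2 * (L * s)"
    using upper[of g] s(1) by (simp add: mult_left_mono divide_right_mono)
  also have "\<dots> = (\<integral>w. (e w)\<^sup>2 \<partial>M) - s / L" using \<open>L > 0\<close> by (simp add: power2_eq_square)
  finally have "s / L \<le> (\<integral>w. (e w)\<^sup>2 \<partial>M)" by simp
  then show ?thesis using \<open>L > 0\<close> unfolding s_def[symmetric] by (simp add: pos_divide_le_eq mult.commute)
qed

text \<open>
  The penalty on the support of the given approximation y can be arbitrarily small; it is there only to
  make a minimiser exist.
\<close>

lemma sparse_surrogate:
  fixes f :: "nat \<Rightarrow> 'a \<Rightarrow> real"
  assumes f: "\<And>j. j < k \<Longrightarrow> sq_int M (f j)" and a: "sq_int M a"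
    and upper: "\<And>x. (\<integral>w. (\<Sum>j<k. x j * f j w)\<^sup>2 \<partial>M) \<le> L * (\<Sum>j<k. (x j)\<^sup>2)"
    and "L > 0" "lam > 0" "q > 0"
    and y: "card {j. j < k \<and> y j \<noteq> 0} = s" "(\<integral>w. (a w - (\<Sum>j<k. y j * f j w))\<^sup>2 \<partial>M) \<le> q"
  shows "\<exists>x. (\<integral>w. (a w - (\<Sum>j<k. x j * f j w))\<^sup>2 \<partial>M) \<le> 2 * q \<and>
    (\<forall>j<k. \<bar>\<integral>w. f j w * (a w - (\<Sum>j<k. x j * f j w)) \<partial>M\<bar> \<le> lam) \<and>
    real (card {j. j < k \<and> x j \<noteq> 0}) \<le> real s + 2 * L * q / lam\<^sup>2"
proof -
  define S where "S = {j. j < k \<and> y j \<noteq> 0}"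
  define n1 where "n1 = (\<Sum>j<k. \<bar>y j\<bar>)"
  \<comment> \<open>The penalty paid by y is 2 * \<eta> * n1, and this choice keeps it below q, so
    that the objective at y is at most 2 q. The +1 covers the case y = 0.\<close>
  define \<eta> where "\<eta> = min lam (q / (2 * (n1 + 1)))"
  have n1: "n1 \<ge> 0" by (simp add: n1_def sum_nonneg)
  have \<eta>: "\<eta> > 0" "\<eta> \<le> lam" using n1 \<open>q > 0\<close> \<open>lam > 0\<close> by (auto simp: \<eta>_def)
  have "\<eta> * n1 \<le> q / (2 * (n1 + 1)) * (n1 + 1)"
    using n1 \<open>q > 0\<close> \<eta> by (intro mult_mono) (auto simp: \<eta>_def)
  also have "\<dots> = q / 2" using n1 by (simp add: field_simps)
  finally have \<eta>n: "2 * (\<eta> * n1) \<le> q" by simp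
  define v where "v j = (if j \<in> S then \<eta> else lam)" for j
  have v: "v j > 0" "v j \<le> lam" for j using \<eta> \<open>lam > 0\<close> by (auto simp: v_def)
  let ?F = "\<lambda>x. (\<integral>w. (a w - (\<Sum>j<k. x j * f j w))\<^sup>2 \<partial>M) + 2 * (\<Sum>j<k. v j * \<bar>x j\<bar>)"
  obtain x where x: "\<And>y. ?F x \<le> ?F y"
    using weighted_l1_minimizer_exists[of k M f a v] f a v(1) by blast
  let ?e = "\<lambda>w. a w - (\<Sum>j<k. x j * f j w)"
  let ?g = "\<lambda>j. \<integral>w. f j w * ?e w \<partial>M"
  have e: "sq_int M ?e" using a f by (intro sq_int_diff sq_int_sum) auto
  have "(\<Sum>j<k. v j * \<bar>y j\<bar>) = \<eta> * n1"
    unfolding n1_def sum_distrib_left by (intro sum.cong) (auto simp: v_def S_def)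
  then have "?F y \<le> 2 * q" using y(2) \<eta>n by simp
  moreover have "0 \<le> (\<Sum>j<k. v j * \<bar>x j\<bar>)" using v by (intro sum_nonneg) (auto simp: less_imp_le)
  ultimately have err: "(\<integral>w. (?e w)\<^sup>2 \<partial>M) \<le> 2 * q" using x[of y] by linarith
  have KKT: "\<bar>?g j\<bar> \<le> v j" "x j \<noteq> 0 \<Longrightarrow> \<bar>?g j\<bar> = v j" if "j < k" for j
    using weighted_l1_minimizer_KKT[OF f a x less_imp_le[OF v(1)] that] by auto
  define T where "T = {j. j < k \<and> x j \<noteq> 0} - S"
  have "lam\<^sup>2 * real (card T) = (\<Sum>j\<in>T. lam\<^sup>2)" by simp
  also have "\<dots> = (\<Sum>j\<in>T. (?g j)\<^sup>2)"
  proof (rule sum.cong[OF refl])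
    fix j assume "j \<in> T"
    then have "\<bar>?g j\<bar> = lam" using KKT(2)[of j] by (auto simp: T_def v_def)
    then show "lam\<^sup>2 = (?g j)\<^sup>2" by (metis power2_abs)
  qed
  also have "\<dots> \<le> L * (\<integral>w. (?e w)\<^sup>2 \<partial>M)"
    by (rule bessel_upper_bound[OF f e upper \<open>L > 0\<close>]) (auto simp: T_def)
  also have "\<dots> \<le> L * (2 * q)" using err \<open>L > 0\<close> by (intro mult_left_mono) auto
  finally have T: "real (card T) \<le> 2 * L * q / lam\<^sup>2" using \<open>lam > 0\<close> by (simp add: field_simps)
  have "card {j. j < k \<and> x j \<noteq> 0} \<le> card (S \<union> T)"
    by (rule card_mono) (auto simp: S_def T_def)
  also have "\<dots> \<le> s + card T" using y(1) card_Un_le[of S T] by (simp add: S_def)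
  finally have "real (card {j. j < k \<and> x j \<noteq> 0}) \<le> real s + 2 * L * q / lam\<^sup>2" using T by linarith
  moreover have "\<forall>j<k. \<bar>?g j\<bar> \<le> lam" using KKT(1) v(2) by (meson order_trans)
  ultimately show ?thesis using err by blast
qed

subsection \<open>A uniform bound for empirical means\<close>

text \<open>This lets the second moment, rather than the range, govern the exponential moments
  below. For negative x the bound follows by taking the reciprocal of the quadratic Taylor lower
  bound of exp (- x).\<close>

lemma exp_le_quadratic:
  fixes x :: real
  assumes "\<bar>x\<bar> \<le> 1"
  shows "exp x \<le> 1 + x + x\<^sup>2"
proof (cases "x \<ge> 0")
  case True
  then show ?thesis using assms exp_bound[of x] by simp
next
  case False
  define y where "y = - x"
  have y: "y > 0" using False by (simp add: y_def)
  have "exp x = 1 / exp y" by (simp add: y_def exp_minus field_simps)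
  also have "\<dots> \<le> 1 / (1 + y + y\<^sup>2 / 2)"
    using y exp_lower_Taylor_quadratic[of y] by (intro divide_left_mono) (auto simp: add_pos_nonneg)
  also have "\<dots> \<le> 1 - y + y\<^sup>2"
  proof -
    have "1 \<le> 1 + (y\<^sup>2 + y ^ 3 + y ^ 4) / 2" using y by simp
    also have "\<dots> = (1 - y + y\<^sup>2) * (1 + y + y\<^sup>2 / 2)"
      by (simp add: algebra_simps power2_eq_square power3_eq_cube power4_eq_xxxx) (simp add: field_simps)
    finally show ?thesis using y by (subst pos_divide_le_eq) (auto simp: add_pos_nonneg)
  qed
  finally show ?thesis by (simp add: y_def)
qed

text \<open>A Bernstein type estimate. Centring at most doubles the bound 1 / 2, which leaves the
  exponent within the range of \<open>exp_le_quadratic\<close>; the linear term integrates to 0 and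
  the variance is at most the second moment.\<close>

lemma (in prob_space) exp_moment_bound:
  fixes Z :: "'a \<Rightarrow> real"
  assumes Z: "Z \<in> borel_measurable M" and bd: "AE w in M. \<bar>lam * Z w\<bar> \<le> 1 / 2"
    and "lam > 0" and V: "(\<integral>w. (Z w)\<^sup>2 \<partial>M) \<le> V"
  defines "D \<equiv> \<lambda>w. exp (lam * (Z w - (\<integral>w. Z w \<partial>M)))"
  shows "integrable M D" and "(\<integral>w. D w \<partial>M) \<le> exp (lam\<^sup>2 * V)"
proof -
  define \<mu> where "\<mu> = (\<integral>w. Z w \<partial>M)"
  have le: "AE w in M. \<bar>Z w\<bar> \<le> 1 / (2 * lam)"
    using bd by eventually_elim (use \<open>lam > 0\<close> in \<open>simp add: abs_mult field_simps\<close>)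
  then have Zint: "integrable M Z"
    by (intro integrable_const_bound[where B = "1 / (2 * lam)"]) (auto simp: Z)
  have "AE w in M. \<bar>(Z w)\<^sup>2\<bar> \<le> (1 / (2 * lam))\<^sup>2"
    using le by eventually_elim (metis abs_ge_zero abs_power2 power2_abs power_mono)
  then have Z2int: "integrable M (\<lambda>w. (Z w)\<^sup>2)"
    using Z by (intro integrable_const_bound[where B = "(1 / (2 * lam))\<^sup>2"]) auto
  have "\<bar>\<mu>\<bar> \<le> (\<integral>w. \<bar>Z w\<bar> \<partial>M)" unfolding \<mu>_def by (rule integral_abs_bound)
  also have "\<dots> \<le> (\<integral>w. 1 / (2 * lam) \<partial>M)"
    using Zint le by (intro integral_mono_AE) auto
  finally have \<mu>: "\<bar>\<mu>\<bar> \<le> 1 / (2 * lam)" by (simp add: prob_space)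
  have b1: "AE w in M. \<bar>lam * (Z w - \<mu>)\<bar> \<le> 1"
    using le
  proof eventually_elim
    case (elim w)
    then have "\<bar>Z w - \<mu>\<bar> \<le> 1 / lam" using \<mu> by (simp add: field_simps)
    then have "lam * \<bar>Z w - \<mu>\<bar> \<le> 1" using \<open>lam > 0\<close> by (simp add: field_simps)
    then show ?case using \<open>lam > 0\<close> by (simp only: abs_mult abs_of_pos)
  qed
  have "AE w in M. norm (D w) \<le> exp 1"
    using b1 by eventually_elim (auto simp: D_def \<mu>_def[symmetric])
  then show Dint: "integrable M D"
    using Z by (intro integrable_const_bound) (auto simp: D_def)
  let ?u = "\<lambda>w. 1 + lam * (Z w - \<mu>) + lam\<^sup>2 * ((Z w)\<^sup>2 - 2 * \<mu> * Z w + \<mu>\<^sup>2)"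
  have "(\<integral>w. D w \<partial>M) \<le> (\<integral>w. ?u w \<partial>M)"
  proof (rule integral_mono_AE[OF Dint])
    show "integrable M ?u" using Zint Z2int by simp
    show "AE w in M. D w \<le> ?u w"
      using b1
    proof eventually_elim
      case (elim w)
      then show ?case
        using exp_le_quadratic[OF elim]
        by (simp add: D_def \<mu>_def[symmetric] power2_eq_square algebra_simps)
    qed
  qed
  also have "\<dots> = 1 + lam\<^sup>2 * ((\<integral>w. (Z w)\<^sup>2 \<partial>M) - \<mu>\<^sup>2)"
    using Zint Z2int by (simp add: prob_space \<mu>_def[symmetric] power2_eq_square algebra_simps)
  also have "\<dots> \<le> 1 + lam\<^sup>2 * V"
    using V by (intro add_left_mono mult_left_mono) (auto intro: order_trans[rotated])
  also have "\<dots> \<le> exp (lam\<^sup>2 * V)" by (rule exp_ge_add_one_self)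
  finally show "(\<integral>w. D w \<partial>M) \<le> exp (lam\<^sup>2 * V)" .
qed

text \<open>Chernoff's bound. The parameter lam is not optimised out: in the application lam is the
  deviation scale itself, t is a multiple of lam, and n * lam^2 equals the logarithm of the number
  of dictionary functions.\<close>

lemma (in prob_space) iid_mean_tail:
  fixes Z :: "'w \<Rightarrow> real"
  assumes P: "prob_space P" and indep: "indep_vars (\<lambda>_. P) W {1..}"
    and ident: "\<And>i. i \<ge> 1 \<Longrightarrow> distr M P (W i) = P"
    and Z: "Z \<in> borel_measurable P" and bd: "AE w in P. \<bar>lam * Z w\<bar> \<le> 1 / 2"
    and "lam > 0" and V: "(\<integral>w. (Z w)\<^sup>2 \<partial>P) \<le> V" and n: "n \<ge> (1 :: nat)"
  shows "prob {\<omega> \<in> space M. (1 / real n) * (\<Sum>l=1..n. Z (W l \<omega>)) - (\<integral>w. Z w \<partial>P) > t}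
      \<le> exp (real n * (lam\<^sup>2 * V - lam * t))"
proof -
  interpret P: prob_space P by (rule P)
  define \<mu> where "\<mu> = (\<integral>w. Z w \<partial>P)"
  define D where "D = (\<lambda>w. exp (lam * (Z w - \<mu>)))"
  have D: "integrable P D" "(\<integral>w. D w \<partial>P) \<le> exp (lam\<^sup>2 * V)"
    using P.exp_moment_bound[OF Z bd \<open>lam > 0\<close> V] by (simp_all add: D_def \<mu>_def)
  have Dm: "D \<in> borel_measurable P" using Z by (simp add: D_def)
  have W: "W i \<in> measurable M P" if "i \<ge> 1" for i
    using indep that by (auto simp: indep_vars_def)
  have "indep_vars (\<lambda>_. P) W {1..n}" by (rule indep_vars_subset[OF indep]) auto
  then have ind: "indep_vars (\<lambda>_. borel) (\<lambda>i \<omega>. D (W i \<omega>)) {1..n}"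
    by (rule indep_vars_compose2) (rule Dm)
  have int: "integrable M (\<lambda>\<omega>. D (W i \<omega>))" and val: "(\<integral>\<omega>. D (W i \<omega>) \<partial>M) = (\<integral>w. D w \<partial>P)"
    if "i \<ge> 1" for i
    using D(1) integrable_distr[OF W[OF that], of D] integral_distr[OF W[OF that] Dm] ident[OF that] by auto
  let ?A = "{\<omega> \<in> space M. exp (real n * lam * t) \<le> (\<Prod>i=1..n. D (W i \<omega>))}"
  have meas: "(\<lambda>\<omega>. \<Prod>i=1..n. D (W i \<omega>)) \<in> borel_measurable M"
    using int by (intro borel_measurable_prod borel_measurable_integrable) auto
  have "prob {\<omega> \<in> space M. (1 / real n) * (\<Sum>l=1..n. Z (W l \<omega>)) - \<mu> > t} \<le> prob ?A"
  proof (rule finite_measure_mono)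
    show "?A \<in> sets M" using meas by measurable
    show "{\<omega> \<in> space M. (1 / real n) * (\<Sum>l=1..n. Z (W l \<omega>)) - \<mu> > t} \<subseteq> ?A"
    proof safe
      fix \<omega> assume "t < (1 / real n) * (\<Sum>l=1..n. Z (W l \<omega>)) - \<mu>"
      then have "real n * t \<le> (\<Sum>l=1..n. Z (W l \<omega>)) - real n * \<mu>"
        using n by (simp add: field_simps)
      then have "lam * (real n * t) \<le> lam * ((\<Sum>l=1..n. Z (W l \<omega>)) - real n * \<mu>)"
        using \<open>lam > 0\<close> by (intro mult_left_mono) auto
      also have "\<dots> = (\<Sum>l=1..n. lam * (Z (W l \<omega>) - \<mu>))"
        by (simp add: sum_subtractf flip: sum_distrib_left)
      finally show "exp (real n * lam * t) \<le> (\<Prod>i=1..n. D (W i \<omega>))"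
        by (simp add: D_def mult_ac flip: exp_sum)
    qed
  qed
  also have "\<dots> \<le> (\<integral>\<omega>. (\<Prod>i=1..n. D (W i \<omega>)) \<partial>M) / exp (real n * lam * t)"
    using indep_vars_integrable[OF _ ind] int
    by (intro integral_Markov_inequality_measure[where A = "{}"]) (auto simp: D_def intro!: prod_nonneg)
  also have "(\<integral>\<omega>. (\<Prod>i=1..n. D (W i \<omega>)) \<partial>M) = (\<integral>w. D w \<partial>P) ^ n"
    using indep_vars_lebesgue_integral[OF _ ind] int val by simp
  also have "\<dots> / exp (real n * lam * t) \<le> exp (lam\<^sup>2 * V) ^ n / exp (real n * lam * t)"
    using D(2) by (intro divide_right_mono power_mono) (auto simp: D_def)
  also have "\<dots> = exp (real n * (lam\<^sup>2 * V - lam * t))"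
    by (simp add: exp_diff exp_of_nat_mult right_diff_distrib mult.assoc)
  finally show ?thesis by (simp add: \<mu>_def)
qed

text \<open>The size of \<open>B\<close> for a union bound over 2 p one-sided events: 1 absorbs the
  factor p, v the variance term, and the last summand produces \<delta>. As the exponent 1 + v - B
  is not positive, p = 2 is the worst case, which explains the division by ln 2.\<close>

lemma exp_mult_le:
  fixes p :: real
  assumes "p \<ge> 2" "B = 1 + v + \<bar>ln (4 / \<delta>)\<bar> / ln 2" "\<delta> > 0"
  shows "2 * p * exp (ln p * (v - B)) \<le> \<delta> / 2"
proof -
  have "2 * p * exp (ln p * (v - B)) = 2 * exp (ln p * (1 + v - B))"
    using assms(1) by (simp add: algebra_simps exp_add exp_diff)
  also have "\<dots> \<le> 2 * exp (ln 2 * (1 + v - B))"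
  proof -
    have "1 + v - B \<le> 0" using assms(2) by simp
    then show ?thesis using assms(1) mult_right_mono_neg[of "ln 2" "ln p"] by simp
  qed
  also have "\<dots> = 2 * exp (- \<bar>ln (4 / \<delta>)\<bar>)" by (simp add: assms(2))
  also have "\<dots> \<le> 2 * exp (- ln (4 / \<delta>))" by simp
  also have "\<dots> = \<delta> / 2" using assms(3) by (simp add: exp_minus)
  finally show ?thesis .
qed

text \<open>
  Only the second moment of g is bounded. Truncating g at the level T keeps the exponential moments
  of the truncated products at the scale lam under control, while the discarded part has first
  moment at most V / T, which is again of order lam.
\<close>

lemma (in prob_space) uniform_empirical_bound:
  fixes f :: "nat \<Rightarrow> 'w \<Rightarrow> real"
  assumes P: "prob_space P" and indep: "indep_vars (\<lambda>_. P) W {1..}"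
    and ident: "\<And>i. i \<ge> 1 \<Longrightarrow> distr M P (W i) = P"
    and f: "\<And>j. f j \<in> borel_measurable P" "AE w in P. \<forall>j. \<bar>f j w\<bar> \<le> C"
    and "C > 0" "V \<ge> 0" "\<delta> > 0"
  shows "\<exists>B>0. \<forall>n\<ge>1. \<forall>k\<ge>2. \<forall>g. sq_int P g \<and> (\<integral>w. (g w)\<^sup>2 \<partial>P) \<le> V \<longrightarrow>
     prob {\<omega> \<in> space M. \<exists>j<k. \<bar>(1 / real n) * (\<Sum>l=1..n. f j (W l \<omega>) * g (W l \<omega>))
        - (\<integral>w. f j w * g w \<partial>P)\<bar> > B * sqrt (ln (real k) / real n)} \<le> \<delta>"
proof -
  interpret P: prob_space P by (rule P)
  \<comment> \<open>\<open>B1\<close> is for the truncated part and \<open>B2\<close> for the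
    discarded part. Both depend only on C, V and \<delta>, so the bound is uniform in n, k and g;
    the function g will vary with n.\<close>
  define B1 where "B1 = 1 + C\<^sup>2 * V + \<bar>ln (4 / \<delta>)\<bar> / ln 2"
  define B2 where "B2 = 8 * C\<^sup>2 * V / \<delta> + 1"
  have B1: "B1 > 0" using \<open>V \<ge> 0\<close> by (auto simp: B1_def intro!: add_pos_nonneg)
  have B2: "B2 > 0" using \<open>V \<ge> 0\<close> \<open>\<delta> > 0\<close> by (auto simp: B2_def intro!: add_nonneg_pos divide_nonneg_pos)
  have W: "W i \<in> measurable M P" if "i \<ge> 1" for i
    using indep that by (auto simp: indep_vars_def)
  have "AE \<omega> in M. \<forall>j. \<bar>f j (W l \<omega>)\<bar> \<le> C" if "l \<ge> 1" for l
    by (rule AE_distrD[OF W[OF that]]) (simp only: ident[OF that] f(2))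
  then have AE_f: "AE \<omega> in M. \<forall>l\<ge>1. \<forall>j. \<bar>f j (W l \<omega>)\<bar> \<le> C"
    by (simp add: AE_all_countable)
  have "prob {\<omega> \<in> space M. \<exists>j<k. \<bar>(1 / real n) * (\<Sum>l=1..n. f j (W l \<omega>) * g (W l \<omega>))
        - (\<integral>w. f j w * g w \<partial>P)\<bar> > (B1 + B2) * sqrt (ln (real k) / real n)} \<le> \<delta>"
    if n: "n \<ge> 1" and k: "k \<ge> 2" and g: "sq_int P g" "(\<integral>w. (g w)\<^sup>2 \<partial>P) \<le> V"
    for n k :: nat and g
  proof -
    define lam where "lam = sqrt (ln (real k) / real n)"
    have lam: "lam > 0" using n k by (simp add: lam_def)
    have nlam: "real n * lam\<^sup>2 = ln (real k)" using n k by (simp add: lam_def)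
    \<comment> \<open>The largest level at which lam * C * T is at most 1 / 2, the range needed for
      the exponential moment of the truncated products.\<close>
    define T where "T = 1 / (2 * C * lam)"
    have T: "T > 0" using lam \<open>C > 0\<close> by (simp add: T_def)
    define g1 where "g1 w = (if \<bar>g w\<bar> \<le> T then g w else 0)" for w
    define g2 where "g2 w = (if \<bar>g w\<bar> \<le> T then 0 else g w)" for w
    have gm: "g \<in> borel_measurable P" "integrable P (\<lambda>w. (g w)\<^sup>2)" using g by (auto simp: sq_int_def)
    have g12: "g w = g1 w + g2 w" for w by (simp add: g1_def g2_def)
    have g1m [measurable]: "g1 \<in> borel_measurable P" using gm unfolding g1_def by measurable
    have g2m [measurable]: "g2 \<in> borel_measurable P" using gm unfolding g2_def by measurable
    note f(1) [measurable]
    have g1T: "\<bar>g1 w\<bar> \<le> T" "(g1 w)\<^sup>2 \<le> (g w)\<^sup>2" for w using T by (auto simp: g1_def)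
    have g2T: "\<bar>g2 w\<bar> \<le> (g w)\<^sup>2 / T" for w
    proof (cases "\<bar>g w\<bar> \<le> T")
      case False
      then have "\<bar>g w\<bar> * T \<le> \<bar>g w\<bar> * \<bar>g w\<bar>" by (intro mult_left_mono) auto
      then show ?thesis using T by (simp add: g2_def field_simps power2_eq_square)
    qed (use T in \<open>auto simp: g2_def\<close>)
    have g2int: "integrable P g2"
      using gm g2T T by (intro Bochner_Integration.integrable_bound[of P "\<lambda>w. (g w)\<^sup>2 / T" g2]) auto
    have "(\<integral>w. \<bar>g2 w\<bar> \<partial>P) \<le> (\<integral>w. (g w)\<^sup>2 / T \<partial>P)"
      using gm g2int g2T by (intro integral_mono) auto
    also have "\<dots> \<le> V / T" using g(2) T by (simp add: divide_right_mono)
    also have "\<dots> = 2 * C * V * lam" by (simp add: T_def)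
    finally have Eg2: "(\<integral>w. \<bar>g2 w\<bar> \<partial>P) \<le> 2 * C * V * lam" .

    define Z where "Z j w = f j w * g1 w" for j w
    have Zm [measurable]: "Z j \<in> borel_measurable P" for j unfolding Z_def by measurable
    have Zb: "AE w in P. \<bar>Z j w\<bar> \<le> C * T" for j
      using f(2) 
      by eventually_elim (use g1T(1) \<open>C > 0\<close> in \<open>auto simp: Z_def abs_mult intro!: mult_mono\<close>)
    then have Zint: "integrable P (Z j)" for j
      by (intro P.integrable_const_bound[where B = "C * T"]) auto
    have bd: "AE w in P. \<bar>lam * Z j w\<bar> \<le> 1 / 2" for j
      using Zb[of j]
    proof eventually_elim
      case (elim w)
      then have "lam * \<bar>Z j w\<bar> \<le> lam * (C * T)" using lam by (intro mult_left_mono) auto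
      also have "\<dots> = 1 / 2" using lam \<open>C > 0\<close> by (simp add: T_def)
      finally show ?case using lam by (simp add: abs_mult)
    qed
    have var: "(\<integral>w. (Z j w)\<^sup>2 \<partial>P) \<le> C\<^sup>2 * V" for j
    proof -
      have le: "AE w in P. (Z j w)\<^sup>2 \<le> C\<^sup>2 * (g w)\<^sup>2"
        using f(2)
      proof eventually_elim
        case (elim w)
        then have "\<bar>f j w\<bar> \<le> \<bar>C\<bar>" using \<open>C > 0\<close> by simp
        then have "(f j w)\<^sup>2 \<le> C\<^sup>2" by (simp only: abs_le_square_iff)
        then show ?case using g1T(2)[of w] by (auto simp: Z_def power_mult_distrib intro!: mult_mono)
      qed
      have "integrable P (\<lambda>w. (Z j w)\<^sup>2)"
      proof (rule Bochner_Integration.integrable_bound)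
        show "integrable P (\<lambda>w. C\<^sup>2 * (g w)\<^sup>2)" using gm by simp
        show "AE w in P. norm ((Z j w)\<^sup>2) \<le> norm (C\<^sup>2 * (g w)\<^sup>2)" using le by simp
      qed simp
      then have "(\<integral>w. (Z j w)\<^sup>2 \<partial>P) \<le> (\<integral>w. C\<^sup>2 * (g w)\<^sup>2 \<partial>P)"
        using le gm by (intro integral_mono_AE) auto
      also have "\<dots> \<le> C\<^sup>2 * V" using g(2) by (simp add: mult_left_mono)
      finally show ?thesis .
    qed
    let ?avg = "\<lambda>h \<omega>. (1 / real n) * (\<Sum>l=1..n. h (W l \<omega>) :: real)"
    \<comment> \<open>The sign s = 1 or -1 selects the upper or the lower deviation; each needs its
      own exponential bound.\<close>
    define E where "E s j = {\<omega> \<in> space M. ?avg (\<lambda>w. s * Z j w) \<omega> - (\<integral>w. s * Z j w \<partial>P) > B1 * lam}" for s j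
    have Wm: "(\<lambda>\<omega>. h (W l \<omega>)) \<in> borel_measurable M" if "h \<in> borel_measurable P" "l \<in> {1..n}" for h :: "'w \<Rightarrow> real" and l
      using that W[of l] by (auto intro: measurable_compose)
    have avgm: "?avg h \<in> borel_measurable M" if "h \<in> borel_measurable P" for h
      using Wm[OF that] by (intro borel_measurable_times borel_measurable_sum) auto
    have E_sets: "E s j \<in> sets M" for s j
      using avgm[of "\<lambda>w. s * Z j w"] unfolding E_def by measurable
    have E_prob: "prob (E s j) \<le> exp (ln (real k) * (C\<^sup>2 * V - B1))" if "s \<in> {1, - 1}" for s j
    proof -
      have "prob (E s j) \<le> exp (real n * (lam\<^sup>2 * (C\<^sup>2 * V) - lam * (B1 * lam)))"
        unfolding E_def using that bd[of j] var[of j]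
        by (intro iid_mean_tail[OF P indep ident _ _ lam _ n]) auto
      also have "real n * (lam\<^sup>2 * (C\<^sup>2 * V) - lam * (B1 * lam)) = (real n * lam\<^sup>2) * (C\<^sup>2 * V - B1)"
        by (simp add: power2_eq_square algebra_simps)
      finally show ?thesis by (simp only: nlam)
    qed
    \<comment> \<open>A majorant, independent of j, for the deviation of all discarded products at
      once. A single Markov inequality therefore suffices, where a union bound over j would be far
      too costly with first moments only. Both terms have the same mean, whence the factor 4 in 4
      C^2 V / B2.\<close>
    define U where "U \<omega> = C * (?avg (\<lambda>w. \<bar>g2 w\<bar>) \<omega>) + C * (\<integral>w. \<bar>g2 w\<bar> \<partial>P)" for \<omega>
    define F where "F = {\<omega> \<in> space M. U \<omega> \<ge> B2 * lam}"
    have Um: "U \<in> borel_measurable M"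
      using avgm[of "\<lambda>w. \<bar>g2 w\<bar>"] unfolding U_def[abs_def] by measurable
    then have F_sets: "F \<in> sets M" unfolding F_def by measurable
    have g2W: "integrable M (\<lambda>\<omega>. \<bar>g2 (W l \<omega>)\<bar>)" "(\<integral>\<omega>. \<bar>g2 (W l \<omega>)\<bar> \<partial>M) = (\<integral>w. \<bar>g2 w\<bar> \<partial>P)"
      if "l \<ge> 1" for l
      using integrable_distr[OF W[OF that], of "\<lambda>w. \<bar>g2 w\<bar>"] integral_distr[OF W[OF that], of "\<lambda>w. \<bar>g2 w\<bar>"]
        ident[OF that] g2int by auto
    have Uint: "integrable M U"
      unfolding U_def using g2W(1)
      by (intro Bochner_Integration.integrable_add integrable_mult_right integrable_const
          Bochner_Integration.integrable_sum) auto
    have U0: "U \<omega> \<ge> 0" for \<omega>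
      unfolding U_def using \<open>C > 0\<close>
      by (intro add_nonneg_nonneg mult_nonneg_nonneg sum_nonneg integral_nonneg_AE) auto
    have "prob F \<le> (\<integral>\<omega>. U \<omega> \<partial>M) / (B2 * lam)"
      unfolding F_def using B2 lam U0 Uint
      by (intro integral_Markov_inequality_measure[where A = "{}"]) auto
    also have "(\<integral>\<omega>. U \<omega> \<partial>M) = 2 * C * (\<integral>w. \<bar>g2 w\<bar> \<partial>P)"
    proof -
      have "integrable M (\<lambda>\<omega>. \<Sum>l=1..n. \<bar>g2 (W l \<omega>)\<bar>)"
        using g2W(1) by (intro Bochner_Integration.integrable_sum) auto
      moreover have "(\<integral>\<omega>. (\<Sum>l=1..n. \<bar>g2 (W l \<omega>)\<bar>) \<partial>M) = real n * (\<integral>w. \<bar>g2 w\<bar> \<partial>P)"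
        using g2W by (subst Bochner_Integration.integral_sum) auto
      ultimately show ?thesis using n by (simp add: U_def prob_space)
    qed
    also have "2 * C * (\<integral>w. \<bar>g2 w\<bar> \<partial>P) / (B2 * lam) \<le> 2 * C * (2 * C * V * lam) / (B2 * lam)"
      using Eg2 B2 lam \<open>C > 0\<close> by (intro divide_right_mono mult_left_mono) auto
    also have "\<dots> = 4 * C\<^sup>2 * V / B2" using lam by (simp add: power2_eq_square)
    also have "\<dots> \<le> \<delta> / 2"
    proof -
      have "4 * C\<^sup>2 * V \<le> \<delta> / 2 * B2" using \<open>\<delta> > 0\<close> by (simp add: B2_def field_simps)
      then show ?thesis using B2 by (simp add: pos_divide_le_eq)
    qed
    finally have F_prob: "prob F \<le> \<delta> / 2" .

    let ?bad = "{\<omega> \<in> space M. \<exists>j<k. \<bar>?avg (\<lambda>w. f j w * g w) \<omega> - (\<integral>w. f j w * g w \<partial>P)\<bar> > (B1 + B2) * lam}"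
    let ?E = "(\<Union>j\<in>{..<k}. E 1 j) \<union> (\<Union>j\<in>{..<k}. E (- 1) j)"
    have fg2: "integrable P (\<lambda>w. f j w * g2 w)" "\<bar>\<integral>w. f j w * g2 w \<partial>P\<bar> \<le> C * (\<integral>w. \<bar>g2 w\<bar> \<partial>P)" for j
    proof -
      have le: "AE w in P. \<bar>f j w * g2 w\<bar> \<le> C * \<bar>g2 w\<bar>"
        using f(2) by eventually_elim (auto simp: abs_mult intro!: mult_right_mono)
      show int: "integrable P (\<lambda>w. f j w * g2 w)"
      proof (intro Bochner_Integration.integrable_bound[of P "\<lambda>w. C * \<bar>g2 w\<bar>" "\<lambda>w. f j w * g2 w"])
        show "integrable P (\<lambda>w. C * \<bar>g2 w\<bar>)" using g2int by simp
        show "AE w in P. norm (f j w * g2 w) \<le> norm (C * \<bar>g2 w\<bar>)"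
          by (rule AE_mp[OF le]) (use \<open>C > 0\<close> in \<open>simp add: abs_mult\<close>)
      qed measurable
      have "\<bar>\<integral>w. f j w * g2 w \<partial>P\<bar> \<le> (\<integral>w. \<bar>f j w * g2 w\<bar> \<partial>P)" by (rule integral_abs_bound)
      also have "\<dots> \<le> (\<integral>w. C * \<bar>g2 w\<bar> \<partial>P)"
        using int le g2int by (intro integral_mono_AE) auto
      finally show "\<bar>\<integral>w. f j w * g2 w \<partial>P\<bar> \<le> C * (\<integral>w. \<bar>g2 w\<bar> \<partial>P)" by simp
    qed
    \<comment> \<open>The inclusion holds only off the null set on which some observation violates
      the bound on the dictionary.\<close>
    have "prob ?bad \<le> prob (?E \<union> F)"
    proof (rule finite_measure_mono_AE)
      show "?E \<union> F \<in> sets M" using E_sets F_sets by auto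
      show "AE \<omega> in M. \<omega> \<in> ?bad \<longrightarrow> \<omega> \<in> ?E \<union> F"
        using AE_f
      proof eventually_elim
        case (elim \<omega>)
        show ?case
        proof
          assume "\<omega> \<in> ?bad"
          then obtain j where \<omega>: "\<omega> \<in> space M" and j: "j < k"
            and big: "\<bar>?avg (\<lambda>w. f j w * g w) \<omega> - (\<integral>w. f j w * g w \<partial>P)\<bar> > (B1 + B2) * lam" by blast
          have a: "?avg (\<lambda>w. f j w * g w) \<omega> = ?avg (Z j) \<omega> + ?avg (\<lambda>w. f j w * g2 w) \<omega>"
            by (simp add: g12 Z_def algebra_simps sum.distrib)
          have i: "(\<integral>w. f j w * g w \<partial>P) = (\<integral>w. Z j w \<partial>P) + (\<integral>w. f j w * g2 w \<partial>P)"
          proof -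
            have "(\<lambda>w. f j w * g w) = (\<lambda>w. Z j w + f j w * g2 w)"
              by (simp add: g12 Z_def distrib_left)
            then show ?thesis using Zint[of j] fg2(1)[of j] by simp
          qed
          have "\<bar>\<Sum>l=1..n. f j (W l \<omega>) * g2 (W l \<omega>)\<bar> \<le> (\<Sum>l=1..n. \<bar>f j (W l \<omega>) * g2 (W l \<omega>)\<bar>)"
            by (rule sum_abs)
          also have "\<dots> \<le> (\<Sum>l=1..n. C * \<bar>g2 (W l \<omega>)\<bar>)"
            using elim by (intro sum_mono) (auto simp: abs_mult intro!: mult_right_mono)
          also have "\<dots> = C * (\<Sum>l=1..n. \<bar>g2 (W l \<omega>)\<bar>)" by (rule sum_distrib_left[symmetric])
          finally have "(1 / real n) * \<bar>\<Sum>l=1..n. f j (W l \<omega>) * g2 (W l \<omega>)\<bar>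
              \<le> (1 / real n) * (C * (\<Sum>l=1..n. \<bar>g2 (W l \<omega>)\<bar>))"
            by (rule mult_left_mono) simp
          then have "\<bar>?avg (\<lambda>w. f j w * g2 w) \<omega>\<bar> \<le> C * ?avg (\<lambda>w. \<bar>g2 w\<bar>) \<omega>"
            by (simp add: abs_mult mult_ac)
          then have "\<bar>?avg (\<lambda>w. f j w * g2 w) \<omega> - (\<integral>w. f j w * g2 w \<partial>P)\<bar> \<le> U \<omega>"
            using fg2(2)[of j] unfolding U_def by linarith
          then have "\<bar>?avg (Z j) \<omega> - (\<integral>w. Z j w \<partial>P)\<bar> > B1 * lam \<or> U \<omega> \<ge> B2 * lam"
            using big unfolding a i distrib_right by linarith
          then consider "?avg (Z j) \<omega> - (\<integral>w. Z j w \<partial>P) > B1 * lam"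
            | "- (?avg (Z j) \<omega>) + (\<integral>w. Z j w \<partial>P) > B1 * lam" | "U \<omega> \<ge> B2 * lam" by linarith
          then show "\<omega> \<in> ?E \<union> F"
          proof cases
            case 1
            then have "\<omega> \<in> E 1 j" using \<omega> by (simp add: E_def)
            then show ?thesis using j by blast
          next
            case 2
            then have "\<omega> \<in> E (- 1) j" using \<omega> by (simp add: E_def sum_negf)
            then show ?thesis using j by blast
          next
            case 3
            then show ?thesis using \<omega> by (simp add: F_def)
          qed
        qed
      qed
    qed
    also have "\<dots> \<le> prob ?E + prob F"
      using E_sets F_sets by (intro measure_Un_le) auto
    finally have 1: "prob ?bad \<le> prob ?E + prob F" .
    have 2: "prob ?E \<le> prob (\<Union>j\<in>{..<k}. E 1 j) + prob (\<Union>j\<in>{..<k}. E (- 1) j)"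
      using E_sets by (intro measure_Un_le) auto
    have "prob (\<Union>j\<in>{..<k}. E s j) \<le> real k * exp (ln (real k) * (C\<^sup>2 * V - B1))"
      if "s \<in> {1, - 1}" for s
    proof -
      have "prob (\<Union>j\<in>{..<k}. E s j) \<le> (\<Sum>j<k. prob (E s j))"
        using E_sets by (intro finite_measure_subadditive_finite) auto
      also have "\<dots> \<le> (\<Sum>j<k. exp (ln (real k) * (C\<^sup>2 * V - B1)))"
        using E_prob[OF that] by (intro sum_mono) auto
      finally show ?thesis by simp
    qed
    from 1 2 F_prob this[of 1] this[of "- 1"] exp_mult_le[OF _ B1_def \<open>\<delta> > 0\<close>, of "real k"] k
    have "prob ?bad \<le> \<delta>" by simp
    then show ?thesis by (simp add: lam_def)
  qed
  then show ?thesis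
    using B1 B2 by (intro exI[of _ "B1 + B2"]) auto
qed

subsection \<open>Prediction error of the Lasso\<close>

lemma dict_scalar_prod:
  assumes "\<rho> \<in> carrier_vec k"
  shows "dict b k x \<bullet> \<rho> = (\<Sum>j<k. \<rho> $ j * b j x)"
  using assms by (auto simp: scalar_prod_def dict_def atLeast0LessThan mult.commute intro!: sum.cong)

lemma quadratic_form_vec:
  assumes "A \<in> carrier_mat k k" "\<rho> \<in> carrier_vec k"
  shows "\<rho> \<bullet> (A *\<^sub>v \<rho>) = bilin k (\<lambda>i j. A $$ (i, j)) (\<lambda>j. \<rho> $ j) (\<lambda>j. \<rho> $ j)"
  using assms
  by (auto simp: scalar_prod_def bilin_def atLeast0LessThan sum_distrib_left mult_ac intro!: sum.cong)

lemma lasso_objective_eq: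
  assumes "A \<in> carrier_mat k k" "\<rho> \<in> carrier_vec k"
  shows "lasso_objective m A r \<rho> = - 2 * (\<Sum>j<k. m $ j * \<rho> $ j)
    + bilin k (\<lambda>i j. A $$ (i, j)) (\<lambda>j. \<rho> $ j) (\<lambda>j. \<rho> $ j) + 2 * r * (\<Sum>j<k. \<bar>\<rho> $ j\<bar>)"
  using assms quadratic_form_vec[OF assms]
  by (simp add: lasso_objective_def l1_norm_def l1_norm_on_def scalar_prod_def atLeast0LessThan)

text \<open>Multiplying out the quotient also covers vectors that vanish on J, which the infimum
  excludes; there positive semidefiniteness is enough.\<close>

lemma restricted_eigenvalueD:
  assumes RE: "ereal c \<le> restricted_eigenvalue s A" and A: "A \<in> carrier_mat k k"
    and J: "J \<subseteq> {..<k}" "card J \<le> s"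
    and cone: "(\<Sum>j\<in>{..<k} - J. \<bar>D j\<bar>) \<le> 3 * (\<Sum>j\<in>J. \<bar>D j\<bar>)"
    and psd: "0 \<le> bilin k (\<lambda>i j. A $$ (i, j)) D D"
  shows "c * (\<Sum>j\<in>J. (D j)\<^sup>2) \<le> bilin k (\<lambda>i j. A $$ (i, j)) D D"
proof (cases "\<exists>j\<in>J. D j \<noteq> 0")
  case False
  then have "(\<Sum>j\<in>J. (D j)\<^sup>2) = 0" by (intro sum.neutral) auto
  with psd show ?thesis by simp
next
  case True
  have fJ: "finite J" using J(1) finite_subset by blast
  have idx: "vec k D $ j = D j" if "j \<in> J" for j using that J(1) by auto
  have idx': "vec k D $ j = D j" if "j \<in> {..<k} - J" for j using that by auto
  have sq: "(\<Sum>j\<in>J. (vec k D $ j)\<^sup>2) = (\<Sum>j\<in>J. (D j)\<^sup>2)" using idx by (intro sum.cong) auto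
  have q: "vec k D \<bullet> (A *\<^sub>v vec k D) = bilin k (\<lambda>i j. A $$ (i, j)) D D"
    using A by (subst quadratic_form_vec) (auto intro!: bilin_cong)
  have mem: "vec k D \<in> {\<rho> \<in> carrier_vec (dim_row A).
      l1_norm_on ({..<dim_row A} - J) \<rho> \<le> 3 * l1_norm_on J \<rho> \<and> (\<exists>j\<in>J. \<rho> $ j \<noteq> 0)}"
  proof -
    have "l1_norm_on ({..<k} - J) (vec k D) = (\<Sum>j\<in>{..<k} - J. \<bar>D j\<bar>)"
      "l1_norm_on J (vec k D) = (\<Sum>j\<in>J. \<bar>D j\<bar>)"
      unfolding l1_norm_on_def using idx idx' by (auto intro!: sum.cong)
    moreover have "\<exists>j\<in>J. vec k D $ j \<noteq> 0" using True idx by metis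
    ultimately show ?thesis using A cone by simp
  qed
  have "J \<in> {J. J \<subseteq> {..<dim_row A} \<and> card J \<le> s}" using J A by auto
  then have "ereal c \<le> ereal ((vec k D \<bullet> (A *\<^sub>v vec k D)) / (\<Sum>j\<in>J. (vec k D $ j)\<^sup>2))"
    using RE mem unfolding restricted_eigenvalue_def le_INF_iff by blast
  then have "c \<le> bilin k (\<lambda>i j. A $$ (i, j)) D D / (\<Sum>j\<in>J. (D j)\<^sup>2)"
    by (simp add: q sq)
  moreover have "0 < (\<Sum>j\<in>J. (D j)\<^sup>2)"
  proof -
    obtain j where "j \<in> J" "D j \<noteq> 0" using True by blast
    then show ?thesis using fJ by (intro sum_pos2[of J j]) auto
  qed
  ultimately show ?thesis by (simp add: pos_le_divide_eq)
qed

lemma abs_vec_le_sup_norm: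
  assumes "j < dim_vec v"
  shows "\<bar>v $ j\<bar> \<le> sup_norm v"
  unfolding sup_norm_def using assms by (intro Max_ge) auto

lemma sup_norm_gr_iff:
  assumes "dim_vec v > 0"
  shows "sup_norm v > c \<longleftrightarrow> (\<exists>j<dim_vec v. \<bar>v $ j\<bar> > c)"
  unfolding sup_norm_def using assms by (subst Max_gr_iff) auto

lemma emp_gram_carrier: "emp_gram W X b k n \<omega> \<in> carrier_mat k k"
  by (simp add: emp_gram_def)

text \<open>The gradient of the empirical quadratic form is an empirical mean of a dictionary
  function times one fixed function, the form to which \<open>uniform_empirical_bound\<close>
  applies.\<close>

lemma emp_gram_mult:
  assumes "j < k"
  shows "(\<Sum>i<k. emp_gram W X b k n \<omega> $$ (i, j) * y i)
    = (1 / real n) * (\<Sum>l=1..n. b j (X (W l \<omega>)) * (\<Sum>i<k. y i * b i (X (W l \<omega>))))"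
proof -
  let ?b = "\<lambda>i l. b i (X (W l \<omega>))"
  have "(\<Sum>i<k. emp_gram W X b k n \<omega> $$ (i, j) * y i)
      = (\<Sum>i<k. \<Sum>l=1..n. (1 / real n) * (?b i l * ?b j l) * y i)"
    using assms by (simp add: emp_gram_def sum_distrib_left sum_distrib_right)
  also have "\<dots> = (\<Sum>l=1..n. \<Sum>i<k. (1 / real n) * (?b i l * ?b j l) * y i)" by (rule sum.swap)
  also have "\<dots> = (1 / real n) * (\<Sum>l=1..n. ?b j l * (\<Sum>i<k. y i * ?b i l))"
    by (simp add: sum_distrib_left mult_ac)
  finally show ?thesis .
qed

lemma emp_gram_psd:
  "0 \<le> bilin k (\<lambda>i j. emp_gram W X b k n \<omega> $$ (i, j)) x x"
proof -
  have "bilin k (\<lambda>i j. emp_gram W X b k n \<omega> $$ (i, j)) x x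
      = (\<Sum>j<k. x j * (\<Sum>i<k. emp_gram W X b k n \<omega> $$ (i, j) * x i))"
    unfolding bilin_def by (subst sum.swap) (simp add: sum_distrib_left mult_ac)
  also have "\<dots> = (\<Sum>j<k. x j * ((1 / real n) * (\<Sum>l=1..n. b j (X (W l \<omega>)) * (\<Sum>i<k. x i * b i (X (W l \<omega>))))))"
    by (intro sum.cong refl) (simp only: emp_gram_mult lessThan_iff)
  also have "\<dots> = (\<Sum>j<k. \<Sum>l=1..n. (1 / real n) * (x j * b j (X (W l \<omega>)) * (\<Sum>i<k. x i * b i (X (W l \<omega>)))))"
    by (simp only: sum_distrib_left[of _ _ "{1..n}"] mult_ac)
  also have "\<dots> = (\<Sum>l=1..n. \<Sum>j<k. (1 / real n) * (x j * b j (X (W l \<omega>)) * (\<Sum>i<k. x i * b i (X (W l \<omega>)))))"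
    by (rule sum.swap)
  also have "\<dots> = (1 / real n) * (\<Sum>l=1..n. (\<Sum>i<k. x i * b i (X (W l \<omega>)))\<^sup>2)"
    unfolding power2_eq_square by (simp only: sum_distrib_left[symmetric] sum_distrib_right[symmetric])
  also have "\<dots> \<ge> 0" by (simp add: sum_nonneg)
  finally show ?thesis .
qed

text \<open>The deterministic core for a fixed outcome \<omega>: optimality, noise and restricted
  eigenvalue refer to the sample, the approximation error and L to the population. The l2 bound on
  the coefficients links the two, and splitting the square of a sum doubles 90 to 180 and q to 2
  q.\<close>

lemma lasso_prediction_bound:
  assumes f: "\<And>j. j < k \<Longrightarrow> sq_int P (\<lambda>w. b j (X w))" and a: "sq_int P a"
    and upper: "\<And>x. (\<integral>w. (\<Sum>j<k. x j * b j (X w))\<^sup>2 \<partial>P) \<le> L * (\<Sum>j<k. (x j)\<^sup>2)" and "L > 0"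
    and opt: "is_arg_min (lasso_objective m (emp_gram W X b k n \<omega>) r) (\<lambda>\<rho>. \<rho> \<in> carrier_vec k) \<rho>"
    and err: "(\<integral>w. (a w - (\<Sum>j<k. y j * b j (X w)))\<^sup>2 \<partial>P) \<le> q"
    and sparse: "card {j. j < k \<and> y j \<noteq> 0} \<le> h" "h \<ge> 1" "2 * h \<le> s"
    and noise: "\<And>j. j < k \<Longrightarrow> \<bar>m $ j - (1 / real n) * (\<Sum>l=1..n. b j (X (W l \<omega>)) * (\<Sum>i<k. y i * b i (X (W l \<omega>))))\<bar> \<le> r / 2"
    and RE: "ereal c \<le> restricted_eigenvalue s (emp_gram W X b k n \<omega>)" and "c > 0" "r > 0"
  shows "(\<integral>w. (dict b k (X w) \<bullet> \<rho> - a w)\<^sup>2 \<partial>P) \<le> 180 * L * r\<^sup>2 * real h / c\<^sup>2 + 2 * q"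
proof -
  let ?A = "emp_gram W X b k n \<omega>"
  note A = emp_gram_carrier[of W X b k n \<omega>]
  define S where "S = {j. j < k \<and> y j \<noteq> 0}"
  define D where "D j = \<rho> $ j - y j" for j
  have S: "S \<subseteq> {..<k}" "\<And>j. j < k \<Longrightarrow> j \<notin> S \<Longrightarrow> y j = 0" by (auto simp: S_def)
  have \<rho>: "\<rho> \<in> carrier_vec k" using opt by (simp add: is_arg_min_def)
  have "lasso_objective m ?A r \<rho> \<le> lasso_objective m ?A r (vec k y)"
    using opt by (auto simp: is_arg_min_linorder)
  then have "- 2 * (\<Sum>j<k. m $ j * \<rho> $ j) + bilin k (\<lambda>i j. ?A $$ (i, j)) (\<lambda>j. \<rho> $ j) (\<lambda>j. \<rho> $ j)
        + 2 * r * (\<Sum>j<k. \<bar>\<rho> $ j\<bar>)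
      \<le> - 2 * (\<Sum>j<k. m $ j * y j) + bilin k (\<lambda>i j. ?A $$ (i, j)) y y + 2 * r * (\<Sum>j<k. \<bar>y j\<bar>)"
    using bilin_cong[of k "\<lambda>j. vec k y $ j" y "\<lambda>j. vec k y $ j" y] \<rho>
    by (simp add: lasso_objective_eq[OF A])
  note opt' = this
  have sym: "?A $$ (i, j) = ?A $$ (j, i)" if "i < k" "j < k" for i j
    using that by (simp add: emp_gram_def mult.commute)
  have noise': "\<bar>m $ j - (\<Sum>i<k. ?A $$ (i, j) * y i)\<bar> \<le> r / 2" if "j < k" for j
    using noise[OF that] by (simp only: emp_gram_mult[OF that])
  have basic: "bilin k (\<lambda>i j. ?A $$ (i, j)) D D + r * (\<Sum>j\<in>{..<k} - S. \<bar>D j\<bar>) \<le> 3 * r * (\<Sum>j\<in>S. \<bar>D j\<bar>)"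
    unfolding D_def by (rule lasso_basic_inequality[OF sym S noise' opt' \<open>r > 0\<close>])
  have "(\<Sum>j<k. (D j)\<^sup>2) \<le> 90 * r\<^sup>2 * real h / c\<^sup>2"
  proof (rule lasso_l2_bound[OF S(1) _ sparse(2,3) emp_gram_psd basic _ \<open>c > 0\<close> \<open>r > 0\<close>])
    show "card S \<le> h" using sparse(1) by (simp add: S_def)
  qed (rule restricted_eigenvalueD[OF RE A _ _ _ emp_gram_psd])
  then have "2 * (\<integral>w. (\<Sum>j<k. D j * b j (X w))\<^sup>2 \<partial>P) \<le> 2 * (L * (90 * r\<^sup>2 * real h / c\<^sup>2))"
    using upper[of D] \<open>L > 0\<close> mult_left_mono[of "\<Sum>j<k. (D j)\<^sup>2" "90 * r\<^sup>2 * real h / c\<^sup>2" L] by linarith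
  also have "2 * (L * (90 * r\<^sup>2 * real h / c\<^sup>2)) = 180 * L * r\<^sup>2 * real h / c\<^sup>2" by simp
  finally have D2: "2 * (\<integral>w. (\<Sum>j<k. D j * b j (X w))\<^sup>2 \<partial>P) \<le> 180 * L * r\<^sup>2 * real h / c\<^sup>2" .
  let ?e = "\<lambda>w. (\<Sum>j<k. y j * b j (X w)) - a w"
  have "dict b k (X w) \<bullet> \<rho> - a w = (\<Sum>j<k. D j * b j (X w)) + ?e w" for w
    using \<rho> by (simp add: dict_scalar_prod D_def left_diff_distrib sum_subtractf)
  then have "(\<integral>w. (dict b k (X w) \<bullet> \<rho> - a w)\<^sup>2 \<partial>P) = (\<integral>w. ((\<Sum>j<k. D j * b j (X w)) + ?e w)\<^sup>2 \<partial>P)"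
    by (simp only:)
  also have "\<dots> \<le> 2 * (\<integral>w. (\<Sum>j<k. D j * b j (X w))\<^sup>2 \<partial>P) + 2 * (\<integral>w. (?e w)\<^sup>2 \<partial>P)"
    using f a by (intro integral_sq_add_le sq_int_sum sq_int_diff) auto
  also have "(\<integral>w. (?e w)\<^sup>2 \<partial>P) \<le> q" using err by (simp add: power2_commute)
  finally show ?thesis using D2 by simp
qed

subsection \<open>The rate\<close>

text \<open>E balances squared bias and estimation error: it solves E powr (-2 \<xi>) = E *
  \<epsilon>^2, and the common value is the square of the target rate. Since E is at least 1,
  rounding down loses at most a factor 2, which becomes 4 powr \<xi> in the squared bias.\<close>

lemma sparsity_floor:
  fixes \<epsilon> \<xi> C :: real
  assumes "0 < \<epsilon>" "\<epsilon> \<le> 1" "\<xi> > 0" "C > 0"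
  defines "E \<equiv> \<epsilon> powr (- 2 / (2 * \<xi> + 1))"
  defines "s \<equiv> nat \<lfloor>E\<rfloor>"
  shows "E \<ge> 1" "s \<ge> 1" "real s \<le> E" "(C * real s powr (- \<xi>))\<^sup>2 \<le> C\<^sup>2 * 4 powr \<xi> * E * \<epsilon>\<^sup>2"
    "E * \<epsilon>\<^sup>2 = \<epsilon> powr (4 * \<xi> / (2 * \<xi> + 1))"
    "E * \<epsilon>\<^sup>2 = (\<epsilon> powr (2 * \<xi> / (2 * \<xi> + 1)))\<^sup>2"
proof -
  have "\<epsilon> powr 0 \<le> E"
    unfolding E_def using assms(1-3) by (intro powr_mono') (auto intro!: divide_nonpos_pos)
  then show E1: "E \<ge> 1" using assms(1) by simp
  show s1: "s \<ge> 1" using E1 by (simp add: s_def le_nat_floor)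
  show sE: "real s \<le> E" using E1 by (simp add: s_def)
  have half: "E / 2 \<le> real s"
  proof -
    have "E < real s + 1" using E1 by (simp add: s_def)
    then show ?thesis using s1 by linarith
  qed
  have e2: "\<epsilon>\<^sup>2 = \<epsilon> powr 2" using assms(1) by simp
  show sq: "E * \<epsilon>\<^sup>2 = \<epsilon> powr (4 * \<xi> / (2 * \<xi> + 1))"
  proof -
    have "- 2 / (2 * \<xi> + 1) + 2 = 4 * \<xi> / (2 * \<xi> + 1)"
      using assms(3) by (simp add: field_simps)
    then show ?thesis unfolding E_def e2 powr_add[symmetric] by simp
  qed
  show "E * \<epsilon>\<^sup>2 = (\<epsilon> powr (2 * \<xi> / (2 * \<xi> + 1)))\<^sup>2"
  proof -
    have "4 * \<xi> / (2 * \<xi> + 1) = 2 * \<xi> / (2 * \<xi> + 1) + 2 * \<xi> / (2 * \<xi> + 1)"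
      by (simp flip: add_divide_distrib)
    then show ?thesis unfolding sq by (simp only: powr_add power2_eq_square)
  qed
  have "real s powr (- \<xi>) \<le> (E / 2) powr (- \<xi>)"
    using half E1 assms(3) by (intro powr_mono2') auto
  then have "(C * real s powr (- \<xi>))\<^sup>2 \<le> (C * (E / 2) powr (- \<xi>))\<^sup>2"
    using \<open>C > 0\<close> by (intro power_mono mult_left_mono) auto
  also have "\<dots> = C\<^sup>2 * (E / 2) powr (- 2 * \<xi>)"
    by (simp add: power_mult_distrib power2_eq_square flip: powr_add)
  also have "(E / 2) powr (- 2 * \<xi>) = E powr (- 2 * \<xi>) * 4 powr \<xi>"
  proof -
    have "(2 :: real) powr (- 2 * \<xi>) = inverse ((2 powr 2) powr \<xi>)"
      by (simp only: powr_powr powr_minus mult_minus_left)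
    then show ?thesis using E1 by (simp add: powr_divide field_simps)
  qed
  also have "E powr (- 2 * \<xi>) = E * \<epsilon>\<^sup>2"
    unfolding sq unfolding E_def powr_powr by simp
  finally show "(C * real s powr (- \<xi>))\<^sup>2 \<le> C\<^sup>2 * 4 powr \<xi> * E * \<epsilon>\<^sup>2"
    by (simp add: mult_ac)
qed

theorem theorem1:
  fixes \<Omega> :: "'o measure" and P :: "'w measure" and N :: "'x measure"
    and W :: "nat \<Rightarrow> 'o \<Rightarrow> 'w" and Y :: "'w \<Rightarrow> real" and X :: "'w \<Rightarrow> 'x"
    and \<Gamma> :: "('x \<Rightarrow> real) set" and m :: "'w \<Rightarrow> ('x \<Rightarrow> real) \<Rightarrow> real"
    and \<alpha>0 \<alpha>_bar :: "'x \<Rightarrow> real" and b :: "nat \<Rightarrow> 'x \<Rightarrow> real"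
    and p :: "nat \<Rightarrow> nat" and r \<epsilon> :: "nat \<Rightarrow> real" and \<xi> :: real
    and M_hat \<rho>_hat :: "nat \<Rightarrow> 'o \<Rightarrow> real vec" and \<alpha>_hat :: "nat \<Rightarrow> 'o \<Rightarrow> 'x \<Rightarrow> real"
  \<comment> \<open>i.i.d. data\<close>
  assumes prob_\<Omega>: "prob_space \<Omega>" and prob_P: "prob_space P"
    and indep: "prob_space.indep_vars \<Omega> (\<lambda>_. P) W {1..}"
    and ident: "\<And>i. i \<ge> 1 \<Longrightarrow> distr \<Omega> P (W i) = P"
    and Y: "Y \<in> borel_measurable P" "integrable P (\<lambda>w. (Y w)\<^sup>2)"
    and X: "X \<in> measurable P N"
  \<comment> \<open>the functional and its Riesz representer\<close>
    and \<Gamma>: "closed_linear_subspace P X N \<Gamma>"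
    and m_linear: "\<And>w f g a c. \<lbrakk>w \<in> space P; f \<in> L2_functions P X N; g \<in> L2_functions P X N\<rbrakk> \<Longrightarrow>
          m w (\<lambda>x. a * f x + c * g x) = a * m w f + c * m w g"
    and \<alpha>0: "\<alpha>0 \<in> L2_functions P X N"
    and m_riesz: "\<And>\<gamma>. \<gamma> \<in> L2_functions P X N \<Longrightarrow> integrable P (\<lambda>w. m w \<gamma>) \<and>
          (\<integral>w. m w \<gamma> \<partial>P) = (\<integral>w. \<alpha>0 (X w) * \<gamma> (X w) \<partial>P)"
    and \<alpha>_bar: "is_arg_min (\<lambda>\<alpha>. \<integral>w. (\<alpha>0 (X w) - \<alpha> (X w))\<^sup>2 \<partial>P) (\<lambda>\<alpha>. \<alpha> \<in> \<Gamma>) \<alpha>_bar"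
  \<comment> \<open>tuning sequences and the estimator\<close>
    and p_ge: "\<And>n. n \<ge> 1 \<Longrightarrow> p n \<ge> 2"
    and r_pos: "\<And>n. n \<ge> 1 \<Longrightarrow> r n > 0"
    and \<epsilon>_pos: "\<And>n. n \<ge> 1 \<Longrightarrow> \<epsilon> n > 0"
    and \<epsilon>_rate: "(\<lambda>n. sqrt (ln (real (p n)) / real n)) \<in> O(\<epsilon>)"
    and M_hat: "\<And>n. n \<ge> 1 \<Longrightarrow> random_vec \<Omega> (p n) (M_hat n)"
    and \<rho>_hat: "\<And>n. n \<ge> 1 \<Longrightarrow> random_vec \<Omega> (p n) (\<rho>_hat n)"
    and \<rho>_hat_arg_min: "\<And>n \<omega>. \<lbrakk>n \<ge> 1; \<omega> \<in> space \<Omega>\<rbrakk> \<Longrightarrow>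
          is_arg_min (lasso_objective (M_hat n \<omega>) (emp_gram W X b (p n) n \<omega>) (r n))
            (\<lambda>\<rho>. \<rho> \<in> carrier_vec (p n)) (\<rho>_hat n \<omega>)"
    and \<alpha>_hat: "\<And>n \<omega> x. \<alpha>_hat n \<omega> x = dict b (p n) x \<bullet> \<rho>_hat n \<omega>"
  \<comment> \<open>(1)\<close>
    and b_in_\<Gamma>: "\<And>j. b j \<in> \<Gamma>"
    and b_dense: "\<And>\<alpha> e. \<lbrakk>\<alpha> \<in> \<Gamma>; e > 0\<rbrakk> \<Longrightarrow>
          \<exists>k. \<exists>\<rho>\<in>carrier_vec k. (\<integral>w. (\<alpha> (X w) - dict b k (X w) \<bullet> \<rho>)\<^sup>2 \<partial>P) < e"
  \<comment> \<open>(2)\<close>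
    and \<xi>_pos: "\<xi> > 0"
    and sparse_approx: "\<exists>C>1. \<forall>n\<ge>1. \<forall>s::nat. s \<ge> 1 \<and> real s \<le> C * \<epsilon> n powr (- 2 / (2 * \<xi> + 1)) \<longrightarrow>
          (\<exists>\<rho>\<in>carrier_vec (p n). card {j. j < p n \<and> \<rho> $ j \<noteq> 0} = s \<and>
             l2_norm P (\<lambda>w. \<alpha>_bar (X w) - dict b (p n) (X w) \<bullet> \<rho>) \<le> C * real s powr (- \<xi>))"
  \<comment> \<open>(3)\<close>
    and G_eigenvalue: "\<exists>C. \<forall>n\<ge>1. Max (spectrum (gram P X b (p n))) \<le> C"
    and restricted: "\<exists>C>0. \<exists>c>0. \<forall>s::nat \<Rightarrow> nat. (\<lambda>n. real (s n) * (\<epsilon> n)\<^sup>2) \<longlonglongrightarrow> C \<longrightarrow>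
          with_prob_approaching_one \<Omega>
            (\<lambda>n \<omega>. restricted_eigenvalue (s n) (emp_gram W X b (p n) n \<omega>) \<ge> ereal c)"
  \<comment> \<open>(4)\<close>
    and b_bounded: "\<exists>C>0. AE w in P. (SUP j. ereal \<bar>b j (X w)\<bar>) \<le> ereal C"
  \<comment> \<open>(5)\<close>
    and \<epsilon>_r: "\<epsilon> \<in> o(r)"
    and r_\<epsilon>: "\<And>c::real. c > 0 \<Longrightarrow> r \<in> o(\<lambda>n. real n powr c * \<epsilon> n)"
    and p_growth: "\<exists>C>0. \<forall>n\<ge>1. real (p n) \<le> C * real n powr C"
  \<comment> \<open>(6)\<close>
    and M_hat_rate: "bigo_p \<Omega> (\<lambda>n \<omega>. sup_norm (M_hat n \<omega> - cross_moment P X b \<alpha>_bar (p n))) \<epsilon>"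
    and \<epsilon>_lim: "\<epsilon> \<longlonglongrightarrow> 0"
  shows "\<forall>c>0. smallo_p \<Omega>
           (\<lambda>n \<omega>. l2_norm P (\<lambda>w. \<alpha>_hat n \<omega> (X w) - \<alpha>_bar (X w)))
           (\<lambda>n. real n powr c * \<epsilon> n powr (2 * \<xi> / (2 * \<xi> + 1)))"

proof (intro allI impI)
  fix c0 :: real
  assume c0: "c0 > 0"
  interpret prob_space \<Omega> by (rule prob_\<Omega>)
  interpret P: prob_space P by (rule prob_P)
  let ?f = "\<lambda>j w. b j (X w)"
  let ?a = "\<lambda>w. \<alpha>_bar (X w)"
  have L2: "sq_int P (\<lambda>w. \<gamma> (X w))" if "\<gamma> \<in> \<Gamma>" for \<gamma>
    using \<Gamma> that X by (auto simp: closed_linear_subspace_def L2_functions_def sq_int_def intro: measurable_compose)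
  have f: "sq_int P (?f j)" for j using b_in_\<Gamma> by (rule L2)
  have a: "sq_int P ?a" using \<alpha>_bar by (intro L2) (auto simp: is_arg_min_def)
  have W: "W i \<in> measurable \<Omega> P" if "i \<ge> 1" for i
    using indep that by (auto simp: indep_vars_def)

  \<comment> \<open>Constants supplied by the hypotheses\<close>
  obtain Cb where Cb: "Cb > 0" "AE w in P. \<forall>j. \<bar>?f j w\<bar> \<le> Cb"
    using b_bounded by (auto simp: SUP_le_iff)
  obtain L where "L > 0" and L: "\<And>n x. n \<ge> 1 \<Longrightarrow>
      (\<integral>w. (\<Sum>j<p n. x j * ?f j w)\<^sup>2 \<partial>P) \<le> L * (\<Sum>j<p n. (x j)\<^sup>2)"
  proof -
    obtain C where C: "\<And>n. n \<ge> 1 \<Longrightarrow> Max (spectrum (gram P X b (p n))) \<le> C"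
      using G_eigenvalue by blast
    \<comment> \<open>The bound C carries no sign, whereas later divisions by L require it to be
      positive; hence |C| + 1.\<close>
    have "(\<integral>w. (\<Sum>j<p n. x j * ?f j w)\<^sup>2 \<partial>P) \<le> (\<bar>C\<bar> + 1) * (\<Sum>j<p n. (x j)\<^sup>2)" if n: "n \<ge> 1" for n x
    proof -
      have "(\<integral>w. (\<Sum>j<p n. x j * ?f j w)\<^sup>2 \<partial>P) = bilin (p n) (\<lambda>i j. gram P X b (p n) $$ (i, j)) x x"
        unfolding integral_lincomb_sq[OF f] bilin_def by (auto simp: gram_def intro!: sum.cong)
      also have "\<dots> \<le> Max (spectrum (gram P X b (p n))) * (\<Sum>j<p n. (x j)\<^sup>2)"
        using p_ge[OF n] by (intro bilin_le_Max_spectrum) (auto simp: gram_def mult.commute)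
      also have "\<dots> \<le> (\<bar>C\<bar> + 1) * (\<Sum>j<p n. (x j)\<^sup>2)"
        using C[OF n] by (intro mult_right_mono sum_nonneg) auto
      finally show ?thesis .
    qed
    then show ?thesis by (intro that[of "\<bar>C\<bar> + 1"]) auto
  qed
  obtain Cs where "Cs > 1" and Cs: "\<And>n s. \<lbrakk>n \<ge> 1; s \<ge> 1; real s \<le> Cs * \<epsilon> n powr (- 2 / (2 * \<xi> + 1))\<rbrakk> \<Longrightarrow>
      \<exists>\<rho>\<in>carrier_vec (p n). card {j. j < p n \<and> \<rho> $ j \<noteq> 0} = s \<and>
        l2_norm P (\<lambda>w. ?a w - dict b (p n) (X w) \<bullet> \<rho>) \<le> Cs * real s powr (- \<xi>)"
    using sparse_approx by blast
  obtain C3 c where "C3 > 0" "c > 0" and RE: "\<And>s :: nat \<Rightarrow> nat. (\<lambda>n. real (s n) * (\<epsilon> n)\<^sup>2) \<longlonglongrightarrow> C3 \<Longrightarrow>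
      with_prob_approaching_one \<Omega>
        (\<lambda>n \<omega>. restricted_eigenvalue (s n) (emp_gram W X b (p n) n \<omega>) \<ge> ereal c)"
    using restricted by blast

  \<comment> \<open>A sparse surrogate for each sample size\<close>
  define E where "E n = \<epsilon> n powr (- 2 / (2 * \<xi> + 1))" for n
  define K1 where "K1 = Cs\<^sup>2 * 4 powr \<xi>"
  \<comment> \<open>The support of the given approximation contributes at most E, and the new
    coordinates at most 2 L q / \<epsilon>^2 with q = K1 E \<epsilon>^2.\<close>
  define K2 where "K2 = 1 + 2 * L * K1"
  have K1: "K1 > 0" using \<open>Cs > 1\<close> by (simp add: K1_def)
  have K2: "K2 \<ge> 1" using K1 \<open>L > 0\<close> by (simp add: K2_def)
  have E: "E n \<ge> 1" "E n * (\<epsilon> n)\<^sup>2 = (\<epsilon> n powr (2 * \<xi> / (2 * \<xi> + 1)))\<^sup>2"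
      "E n * (\<epsilon> n)\<^sup>2 = \<epsilon> n powr (4 * \<xi> / (2 * \<xi> + 1))" if "n \<ge> 1" "\<epsilon> n \<le> 1" for n
    using sparsity_floor(1,5,6)[of "\<epsilon> n" \<xi> Cs] that \<epsilon>_pos \<xi>_pos \<open>Cs > 1\<close> unfolding E_def by auto

  define Q where "Q n y \<longleftrightarrow>
      (\<integral>w. (?a w - (\<Sum>j<p n. y j * ?f j w))\<^sup>2 \<partial>P) \<le> 2 * (K1 * E n * (\<epsilon> n)\<^sup>2) \<and>
      (\<forall>j<p n. \<bar>\<integral>w. ?f j w * (?a w - (\<Sum>j<p n. y j * ?f j w)) \<partial>P\<bar> \<le> \<epsilon> n) \<and>
      real (card {j. j < p n \<and> y j \<noteq> 0}) \<le> K2 * E n" for n y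
  have "\<exists>y. n \<ge> 1 \<longrightarrow> \<epsilon> n \<le> 1 \<longrightarrow> Q n y" for n
  proof (cases "n \<ge> 1 \<and> \<epsilon> n \<le> 1")
    case True
    then have n: "n \<ge> 1" and e: "0 < \<epsilon> n" "\<epsilon> n \<le> 1" using \<epsilon>_pos by auto
    define s where "s = nat \<lfloor>E n\<rfloor>"
    note fl = sparsity_floor[OF e \<xi>_pos, of Cs, folded E_def, folded s_def K1_def]
    have "real s \<le> Cs * E n"
      using fl(1,3) \<open>Cs > 1\<close> mult_right_mono[of 1 Cs "E n"] by linarith
    then obtain \<rho> where \<rho>: "\<rho> \<in> carrier_vec (p n)" "card {j. j < p n \<and> \<rho> $ j \<noteq> 0} = s"
        "l2_norm P (\<lambda>w. ?a w - dict b (p n) (X w) \<bullet> \<rho>) \<le> Cs * real s powr (- \<xi>)"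
      using Cs[OF n fl(2)] \<open>Cs > 1\<close> unfolding E_def by auto
    have "(\<integral>w. (?a w - (\<Sum>j<p n. \<rho> $ j * ?f j w))\<^sup>2 \<partial>P)
        = (l2_norm P (\<lambda>w. ?a w - dict b (p n) (X w) \<bullet> \<rho>))\<^sup>2"
      using \<rho>(1) by (simp add: l2_norm_def dict_scalar_prod)
    also have "\<dots> \<le> (Cs * real s powr (- \<xi>))\<^sup>2"
      using \<rho>(3) by (intro power_mono) (auto simp: l2_norm_def)
    also have "\<dots> \<le> K1 * E n * (\<epsilon> n)\<^sup>2" using fl(4) \<open>Cs > 1\<close> by simp
    finally have err: "(\<integral>w. (?a w - (\<Sum>j<p n. \<rho> $ j * ?f j w))\<^sup>2 \<partial>P) \<le> K1 * E n * (\<epsilon> n)\<^sup>2" .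
    have pos: "K1 * E n * (\<epsilon> n)\<^sup>2 > 0" using K1 e fl(1) \<open>Cs > 1\<close> by simp
    have "real s + 2 * L * (K1 * E n * (\<epsilon> n)\<^sup>2) / (\<epsilon> n)\<^sup>2 \<le> K2 * E n"
      using e fl(3) \<open>Cs > 1\<close> by (simp add: K2_def algebra_simps)
    then have "\<exists>y. Q n y"
      using sparse_surrogate[OF f a L[OF n] \<open>L > 0\<close> e(1) pos \<rho>(2) err] unfolding Q_def by force
    then show ?thesis by blast
  qed blast
  \<comment> \<open>The surrogates are fixed before any outcome is considered. Being nonrandom, they
    may serve as the function g in the empirical bound.\<close>
  then have "\<exists>y. \<forall>n. n \<ge> 1 \<longrightarrow> \<epsilon> n \<le> 1 \<longrightarrow> Q n (y n)" by (intro choice allI)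
  then obtain y where "\<And>n. n \<ge> 1 \<Longrightarrow> \<epsilon> n \<le> 1 \<Longrightarrow> Q n (y n)" by blast
  then have y: "\<And>n. \<lbrakk>n \<ge> 1; \<epsilon> n \<le> 1\<rbrakk> \<Longrightarrow>
        (\<integral>w. (?a w - (\<Sum>j<p n. y n j * ?f j w))\<^sup>2 \<partial>P) \<le> 2 * (K1 * E n * (\<epsilon> n)\<^sup>2)"
      "\<And>n j. \<lbrakk>n \<ge> 1; \<epsilon> n \<le> 1; j < p n\<rbrakk> \<Longrightarrow>
        \<bar>\<integral>w. ?f j w * (?a w - (\<Sum>j<p n. y n j * ?f j w)) \<partial>P\<bar> \<le> \<epsilon> n"
      "\<And>n. \<lbrakk>n \<ge> 1; \<epsilon> n \<le> 1\<rbrakk> \<Longrightarrow> real (card {j. j < p n \<and> y n j \<noteq> 0}) \<le> K2 * E n"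
    unfolding Q_def by blast+
  define g where "g n w = (\<Sum>j<p n. y n j * ?f j w)" for n w
  have g: "sq_int P (g n)" for n unfolding g_def using f by (intro sq_int_sum)
  \<comment> \<open>A second moment bound for all surrogates together: twice that of \<alpha>_bar
    plus twice the surrogate error 2 K1 E \<epsilon>^2, where E \<epsilon>^2 is at most 1.\<close>
  define V where "V = 2 * (\<integral>w. (?a w)\<^sup>2 \<partial>P) + 4 * K1"
  have V0: "V \<ge> 0" using K1 by (auto simp: V_def intro!: add_nonneg_nonneg)
  have gV: "(\<integral>w. (g n w)\<^sup>2 \<partial>P) \<le> V" if n: "n \<ge> 1" "\<epsilon> n \<le> 1" for n
  proof -
    have "(\<integral>w. (g n w)\<^sup>2 \<partial>P) = (\<integral>w. (?a w + (g n w - ?a w))\<^sup>2 \<partial>P)" by simp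
    also have "\<dots> \<le> 2 * (\<integral>w. (?a w)\<^sup>2 \<partial>P) + 2 * (\<integral>w. (g n w - ?a w)\<^sup>2 \<partial>P)"
      by (intro integral_sq_add_le a sq_int_diff g)
    also have "(\<integral>w. (g n w - ?a w)\<^sup>2 \<partial>P) \<le> 2 * (K1 * (E n * (\<epsilon> n)\<^sup>2))"
      using y(1)[OF n] by (simp add: g_def power2_commute mult.assoc)
    also have "E n * (\<epsilon> n)\<^sup>2 \<le> 1"
    proof -
      have "\<epsilon> n powr (2 * \<xi> / (2 * \<xi> + 1)) \<le> 1"
        using n \<epsilon>_pos[OF n(1)] \<xi>_pos by (intro powr_le1) auto
      then show ?thesis unfolding E(2)[OF n] by (intro power_le_one) auto
    qed
    finally show ?thesis using K1 by (simp add: V_def)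
  qed

  \<comment> \<open>Probability of a large error\<close>
  show "smallo_p \<Omega> (\<lambda>n \<omega>. l2_norm P (\<lambda>w. \<alpha>_hat n \<omega> (X w) - \<alpha>_bar (X w)))
      (\<lambda>n. real n powr c0 * \<epsilon> n powr (2 * \<xi> / (2 * \<xi> + 1)))"
    unfolding smallo_p_def
  proof (intro allI impI)
    fix d :: real
    assume "d > 0"
    let ?bad = "\<lambda>n. {\<omega> \<in> space \<Omega>. \<bar>l2_norm P (\<lambda>w. \<alpha>_hat n \<omega> (X w) - \<alpha>_bar (X w))\<bar>
        > d * (real n powr c0 * \<epsilon> n powr (2 * \<xi> / (2 * \<xi> + 1)))}"
    have "\<forall>\<^sub>F n in sequentially. prob (?bad n) < \<eta>" if "\<eta> > 0" for \<eta>
    proof -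
      obtain BM where "BM > 0" and BM: "\<forall>\<^sub>F n in sequentially.
          prob {\<omega> \<in> space \<Omega>. \<bar>sup_norm (M_hat n \<omega> - cross_moment P X b \<alpha>_bar (p n))\<bar> > BM * \<epsilon> n} < \<eta> / 4"
        using M_hat_rate \<open>\<eta> > 0\<close> unfolding bigo_p_def by (meson zero_less_divide_iff zero_less_numeral)
      obtain BE where "BE > 0" and BE: "\<And>n k h. \<lbrakk>n \<ge> 1; k \<ge> 2; sq_int P h; (\<integral>w. (h w)\<^sup>2 \<partial>P) \<le> V\<rbrakk> \<Longrightarrow>
          prob {\<omega> \<in> space \<Omega>. \<exists>j<k. \<bar>(1 / real n) * (\<Sum>l=1..n. ?f j (W l \<omega>) * h (W l \<omega>))
            - (\<integral>w. ?f j w * h w \<partial>P)\<bar> > BE * sqrt (ln (real k) / real n)} \<le> \<eta> / 4"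
        using uniform_empirical_bound[OF prob_P indep ident _ Cb(2) Cb(1) V0, of "\<eta> / 4"] f \<open>\<eta> > 0\<close>
        unfolding sq_int_def by auto
      obtain CR where "CR > 0" and CR: "\<forall>\<^sub>F n in sequentially. sqrt (ln (real (p n)) / real n) \<le> CR * \<epsilon> n"
      proof -
        obtain c' where c': "c' > 0" "\<forall>\<^sub>F n in sequentially.
            norm (sqrt (ln (real (p n)) / real n)) \<le> c' * norm (\<epsilon> n)"
          using landau_o.bigE[OF \<epsilon>_rate] by blast
        have "\<forall>\<^sub>F n in sequentially. sqrt (ln (real (p n)) / real n) \<le> c' * \<epsilon> n"
          using c'(2) eventually_ge_at_top[of 1]
        proof eventually_elim
          case (elim n)
          have "sqrt (ln (real (p n)) / real n) \<le> norm (sqrt (ln (real (p n)) / real n))"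
            unfolding real_norm_def by (rule abs_ge_self)
          also have "\<dots> \<le> c' * norm (\<epsilon> n)" by (rule elim(1))
          finally show ?case using \<epsilon>_pos[OF elim(2)] by simp
        qed
        then show ?thesis using c'(1) by (rule that[rotated])
      qed
      \<comment> \<open>One concrete sequence with s n * \<epsilon>^2 tending to \<open>C3\<close>,
        so that the restricted eigenvalue condition can be invoked.\<close>
      define s where "s n = nat \<lfloor>C3 / (\<epsilon> n)\<^sup>2\<rfloor>" for n
      define h where "h n = nat \<lfloor>K2 * E n\<rfloor>" for n
      have e_small: "\<forall>\<^sub>F n in sequentially. \<epsilon> n \<le> t" if "t > 0" for t
        using order_tendstoD(2)[OF \<epsilon>_lim that] by (auto elim: eventually_mono)
      have e_small1: "\<forall>\<^sub>F n in sequentially. \<epsilon> n \<le> 1" by (rule e_small) simp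
      have s_lim: "(\<lambda>n. real (s n) * (\<epsilon> n)\<^sup>2) \<longlonglongrightarrow> C3"
      proof (rule tendsto_sandwich)
        show "\<forall>\<^sub>F n in sequentially. C3 - (\<epsilon> n)\<^sup>2 \<le> real (s n) * (\<epsilon> n)\<^sup>2"
          using eventually_ge_at_top[of 1]
        proof eventually_elim
          case (elim n)
          have "C3 / (\<epsilon> n)\<^sup>2 - 1 \<le> real (s n)" unfolding s_def by linarith
          then have "(C3 / (\<epsilon> n)\<^sup>2 - 1) * (\<epsilon> n)\<^sup>2 \<le> real (s n) * (\<epsilon> n)\<^sup>2" by (intro mult_right_mono) auto
          then show ?case using \<epsilon>_pos[OF elim] by (simp add: left_diff_distrib)
        qed
        show "\<forall>\<^sub>F n in sequentially. real (s n) * (\<epsilon> n)\<^sup>2 \<le> C3"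
          using eventually_ge_at_top[of 1]
        proof eventually_elim
          case (elim n)
          have "real (s n) \<le> C3 / (\<epsilon> n)\<^sup>2" using \<open>C3 > 0\<close> by (simp add: s_def)
          then have "real (s n) * (\<epsilon> n)\<^sup>2 \<le> C3 / (\<epsilon> n)\<^sup>2 * (\<epsilon> n)\<^sup>2" by (intro mult_right_mono) auto
          then show ?case using \<epsilon>_pos[OF elim] by simp
        qed
        have "(\<lambda>n. C3 - (\<epsilon> n)\<^sup>2) \<longlonglongrightarrow> C3 - 0\<^sup>2" by (intro tendsto_intros \<epsilon>_lim)
        then show "(\<lambda>n. C3 - (\<epsilon> n)\<^sup>2) \<longlonglongrightarrow> C3" by simp
      qed auto
      let ?R = "\<lambda>n. {\<omega> \<in> space \<Omega>. restricted_eigenvalue (s n) (emp_gram W X b (p n) n \<omega>) \<ge> ereal c}"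
      \<comment> \<open>The maximum with 0 makes the probability strictly positive even for large
        \<eta>. Measurability of \<open>?R n\<close> is later read off from this, since
        \<open>measure\<close> is 0 on sets that are not measurable.\<close>
      have R_prob: "\<forall>\<^sub>F n in sequentially. prob (?R n) > max 0 (1 - \<eta> / 4)"
        using RE[OF s_lim] \<open>\<eta> > 0\<close> unfolding with_prob_approaching_one_def
        by (intro order_tendstoD(1)) auto
      have hs: "\<forall>\<^sub>F n in sequentially. 2 * h n \<le> s n"
      proof -
        \<comment> \<open>The solution of t powr (4 \<xi> / (2 \<xi> + 1)) = C3 / (2 K2): below this
          level of \<epsilon>, twice the sparsity bound K2 E fits under C3 / \<epsilon>^2.\<close>
        define t where "t = (C3 / (2 * K2)) powr ((2 * \<xi> + 1) / (4 * \<xi>))"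
        have "t > 0" using \<open>C3 > 0\<close> K2 by (simp add: t_def)
        show ?thesis
          using e_small[OF \<open>t > 0\<close>] e_small1 eventually_ge_at_top[of 1]
        proof eventually_elim
          case (elim n)
          have "E n * (\<epsilon> n)\<^sup>2 = \<epsilon> n powr (4 * \<xi> / (2 * \<xi> + 1))"
            by (rule E(3)[OF elim(3,2)])
          also have "\<dots> \<le> t powr (4 * \<xi> / (2 * \<xi> + 1))"
            using elim(1) \<epsilon>_pos[OF elim(3)] \<xi>_pos by (intro powr_mono2) auto
          also have "\<dots> = C3 / (2 * K2)"
            using \<open>C3 > 0\<close> K2 \<xi>_pos by (simp add: t_def powr_powr)
          finally have "2 * (K2 * E n) \<le> C3 / (\<epsilon> n)\<^sup>2"
            using K2 \<epsilon>_pos[OF elim(3)] by (simp add: field_simps)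
          moreover have "real (h n) \<le> K2 * E n"
            using K2 E(1)[OF elim(3,2)] by (simp add: h_def)
          ultimately have "real (2 * h n) \<le> C3 / (\<epsilon> n)\<^sup>2" by simp
          then show ?case unfolding s_def by (rule le_nat_floor)
        qed
      qed
      \<comment> \<open>The three sources of noise in units of \<epsilon>: the error of
        \<open>M_hat\<close>, the inner products of the surrogate residual with the dictionary, and
        the empirical fluctuation. The factor 2 is there because the noise must stay below r /
        2.\<close>
      define B where "B = 2 * (BM + 1 + BE * CR)"
      have "B > 0" using \<open>BM > 0\<close> \<open>BE > 0\<close> \<open>CR > 0\<close> by (simp add: B_def add_pos_pos)
      have er: "\<forall>\<^sub>F n in sequentially. \<epsilon> n \<le> t * r n" if "t > 0" for t
        using landau_o.smallD[OF \<epsilon>_r that] eventually_ge_at_top[of 1]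
        by eventually_elim (simp add: \<epsilon>_pos r_pos less_imp_le)
      have er1: "\<forall>\<^sub>F n in sequentially. \<epsilon> n \<le> 1 * r n" by (rule er) simp
      have erB: "\<forall>\<^sub>F n in sequentially. \<epsilon> n \<le> 1 / B * r n" by (rule er) (use \<open>B > 0\<close> in simp)
      \<comment> \<open>The first summand is the estimation error with h at most K2 E. The second is
        the approximation error after \<epsilon> is replaced by the larger r, so that both are
        multiples of E r^2. The constant d / sqrt K3 in \<open>re\<close> then cancels
        \<open>K3\<close>.\<close>
      define K3 where "K3 = 180 * L * K2 / c\<^sup>2 + 4 * K1"
      have K3: "K3 > 0" using \<open>L > 0\<close> K2 \<open>c > 0\<close> K1 by (auto simp: K3_def intro!: add_nonneg_pos)
      have re: "\<forall>\<^sub>F n in sequentially. r n \<le> d / sqrt K3 * (real n powr c0 * \<epsilon> n)"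
      proof -
        have "d / sqrt K3 > 0" using \<open>d > 0\<close> K3 by simp
        from landau_o.smallD[OF r_\<epsilon>[OF c0] this] eventually_ge_at_top[of 1] show ?thesis
          by eventually_elim (simp add: \<epsilon>_pos r_pos less_imp_le abs_mult)
      qed

      show ?thesis
        using BM CR R_prob hs re er1 erB e_small1 eventually_ge_at_top[of 1]
      proof eventually_elim
        case (elim n)
        note n = elim(9) and e1 = elim(8)
        have e: "\<epsilon> n > 0" using n by (rule \<epsilon>_pos)
        let ?A = "{\<omega> \<in> space \<Omega>. \<bar>sup_norm (M_hat n \<omega> - cross_moment P X b \<alpha>_bar (p n))\<bar> > BM * \<epsilon> n}"
        let ?G = "{\<omega> \<in> space \<Omega>. \<exists>j<p n. \<bar>(1 / real n) * (\<Sum>l=1..n. ?f j (W l \<omega>) * g n (W l \<omega>))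
            - (\<integral>w. ?f j w * g n w \<partial>P)\<bar> > BE * sqrt (ln (real (p n)) / real n)}"
        have dimM: "dim_vec (M_hat n \<omega> - cross_moment P X b \<alpha>_bar (p n)) = p n" for \<omega>
          by (simp add: cross_moment_def)
        have sup0: "sup_norm (M_hat n \<omega> - cross_moment P X b \<alpha>_bar (p n)) \<ge> 0" for \<omega>
          using abs_vec_le_sup_norm[of 0 "M_hat n \<omega> - cross_moment P X b \<alpha>_bar (p n)"] p_ge[OF n]
          unfolding dimM by linarith
        \<comment> \<open>A finite union over coordinates, because measurability of the random
          vectors is given coordinate by coordinate.\<close>
        have "?A = {\<omega> \<in> space \<Omega>. \<exists>j<p n. \<bar>M_hat n \<omega> $ j - (\<integral>w. ?a w * ?f j w \<partial>P)\<bar> > BM * \<epsilon> n}"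
          unfolding abs_of_nonneg[OF sup0] using p_ge[OF n]
          by (subst sup_norm_gr_iff) (auto simp: cross_moment_def)
        also have "\<dots> = (\<Union>j\<in>{..<p n}. {\<omega> \<in> space \<Omega>. \<bar>M_hat n \<omega> $ j - (\<integral>w. ?a w * ?f j w \<partial>P)\<bar> > BM * \<epsilon> n})"
          by auto
        also have "\<dots> \<in> sets \<Omega>"
        proof (rule sets.finite_UN)
          fix j assume "j \<in> {..<p n}"
          then have [measurable]: "(\<lambda>\<omega>. M_hat n \<omega> $ j) \<in> borel_measurable \<Omega>"
            using M_hat[OF n] by (auto simp: random_vec_def)
          show "{\<omega> \<in> space \<Omega>. \<bar>M_hat n \<omega> $ j - (\<integral>w. ?a w * ?f j w \<partial>P)\<bar> > BM * \<epsilon> n} \<in> sets \<Omega>"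
            by measurable
        qed simp
        finally have A_sets: "?A \<in> sets \<Omega>" .
        have "?G = (\<Union>j\<in>{..<p n}. {\<omega> \<in> space \<Omega>. \<bar>(1 / real n) * (\<Sum>l=1..n. ?f j (W l \<omega>) * g n (W l \<omega>))
            - (\<integral>w. ?f j w * g n w \<partial>P)\<bar> > BE * sqrt (ln (real (p n)) / real n)})"
          by auto
        also have "\<dots> \<in> sets \<Omega>"
        proof (rule sets.finite_UN)
          fix j
          have "(\<lambda>w. ?f j w * g n w) \<in> borel_measurable P"
            using f[of j] g[of n] unfolding sq_int_def by (intro borel_measurable_times) auto
          then have "(\<lambda>\<omega>. ?f j (W l \<omega>) * g n (W l \<omega>)) \<in> borel_measurable \<Omega>" if "l \<in> {1..n}" for l
            using measurable_compose[OF W[of l]] that by auto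
          then have [measurable]: "(\<lambda>\<omega>. \<Sum>l=1..n. ?f j (W l \<omega>) * g n (W l \<omega>)) \<in> borel_measurable \<Omega>"
            by (rule borel_measurable_sum)
          show "{\<omega> \<in> space \<Omega>. \<bar>(1 / real n) * (\<Sum>l=1..n. ?f j (W l \<omega>) * g n (W l \<omega>))
            - (\<integral>w. ?f j w * g n w \<partial>P)\<bar> > BE * sqrt (ln (real (p n)) / real n)} \<in> sets \<Omega>"
            by measurable
        qed simp
        finally have G_sets: "?G \<in> sets \<Omega>" .
        have R_sets: "?R n \<in> sets \<Omega>"
          using elim(3) measure_notin_sets[of "?R n" \<Omega>] by fastforce
        \<comment> \<open>On the complement of the three exceptional events the deterministic bound
          applies. Each of them has probability at most \<eta> / 4, so their sum stays strictly
          below \<eta>.\<close>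
        have "?bad n \<subseteq> ?A \<union> ?G \<union> (space \<Omega> - ?R n)"
        proof (rule subsetI, rule ccontr)
          fix \<omega>
          assume bad: "\<omega> \<in> ?bad n" and "\<omega> \<notin> ?A \<union> ?G \<union> (space \<Omega> - ?R n)"
          then have \<omega>: "\<omega> \<in> space \<Omega>" and not_in: "\<omega> \<notin> ?A" "\<omega> \<notin> ?G" "\<omega> \<in> ?R n"
            by auto
          have nA: "\<bar>sup_norm (M_hat n \<omega> - cross_moment P X b \<alpha>_bar (p n))\<bar> \<le> BM * \<epsilon> n"
            using not_in(1) \<omega> by (simp add: not_less)
          have nG: "\<bar>(1 / real n) * (\<Sum>l=1..n. ?f j (W l \<omega>) * g n (W l \<omega>))
              - (\<integral>w. ?f j w * g n w \<partial>P)\<bar> \<le> BE * sqrt (ln (real (p n)) / real n)" if "j < p n" for j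
          proof (rule leI, rule notI)
            assume "BE * sqrt (ln (real (p n)) / real n) < \<bar>(1 / real n) * (\<Sum>l=1..n. ?f j (W l \<omega>) * g n (W l \<omega>))
              - (\<integral>w. ?f j w * g n w \<partial>P)\<bar>"
            then have "\<omega> \<in> ?G" using \<omega> that by (intro CollectI conjI exI)
            then show False using not_in(2) by contradiction
          qed
          have R: "restricted_eigenvalue (s n) (emp_gram W X b (p n) n \<omega>) \<ge> ereal c"
            using not_in(3) by simp
          have noise: "\<bar>M_hat n \<omega> $ j - (1 / real n) * (\<Sum>l=1..n. ?f j (W l \<omega>) * g n (W l \<omega>))\<bar> \<le> r n / 2"
            if j: "j < p n" for j
          proof -
            have 1: "\<bar>M_hat n \<omega> $ j - (\<integral>w. ?a w * ?f j w \<partial>P)\<bar> \<le> BM * \<epsilon> n"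
              using abs_vec_le_sup_norm[of j "M_hat n \<omega> - cross_moment P X b \<alpha>_bar (p n)"] nA j
              by (simp add: cross_moment_def)
            have "(\<integral>w. ?f j w * (?a w - g n w) \<partial>P) = (\<integral>w. ?a w * ?f j w \<partial>P) - (\<integral>w. ?f j w * g n w \<partial>P)"
              using sq_int_mult[OF a f[of j]] sq_int_mult[OF f[of j] g[of n]]
              by (simp add: right_diff_distrib mult.commute)
            then have 2: "\<bar>(\<integral>w. ?a w * ?f j w \<partial>P) - (\<integral>w. ?f j w * g n w \<partial>P)\<bar> \<le> \<epsilon> n"
              using y(2)[OF n e1 j] by (simp add: g_def)
            have 3: "BE * sqrt (ln (real (p n)) / real n) \<le> BE * (CR * \<epsilon> n)"
              using elim(2) \<open>BE > 0\<close> by (intro mult_left_mono) auto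
            have 4: "2 * (BM * \<epsilon> n + \<epsilon> n + BE * (CR * \<epsilon> n)) \<le> r n"
              using elim(7) \<open>B > 0\<close> by (simp add: B_def field_simps)
            have "\<bar>x - z\<bar> \<le> t / 2"
              if "\<bar>x - m\<bar> \<le> A" "\<bar>m - i\<bar> \<le> B" "S \<le> C" "2 * (A + B + C) \<le> t" "\<bar>z - i\<bar> \<le> S"
              for x z m i A B C S t :: real
              using that by argo
            from this[OF 1 2 3 4 nG[OF j]] show ?thesis .
          qed
          have h1: "h n \<ge> 1" and hE: "real (h n) \<le> K2 * E n"
            and card: "card {j. j < p n \<and> y n j \<noteq> 0} \<le> h n"
          proof -
            have "1 \<le> K2 * E n" using K2 E(1)[OF n e1] mult_mono[of 1 K2 1 "E n"] by simp
            then show "h n \<ge> 1" "real (h n) \<le> K2 * E n" by (simp_all add: h_def le_nat_floor)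
            show "card {j. j < p n \<and> y n j \<noteq> 0} \<le> h n"
              unfolding h_def by (rule le_nat_floor) (rule y(3)[OF n e1])
          qed
          have r: "r n > 0" using n by (rule r_pos)
          have "(\<integral>w. (\<alpha>_hat n \<omega> (X w) - \<alpha>_bar (X w))\<^sup>2 \<partial>P)
              \<le> 180 * L * (r n)\<^sup>2 * real (h n) / c\<^sup>2 + 2 * (2 * (K1 * E n * (\<epsilon> n)\<^sup>2))"
            unfolding \<alpha>_hat
            using noise unfolding g_def
            by (intro lasso_prediction_bound[OF f a L[OF n] \<open>L > 0\<close> \<rho>_hat_arg_min[OF n \<omega>] y(1)[OF n e1]
                  card h1 elim(4) _ R \<open>c > 0\<close> r])
          also have "\<dots> \<le> 180 * L * (r n)\<^sup>2 * (K2 * E n) / c\<^sup>2 + 2 * (2 * (K1 * E n * (r n)\<^sup>2))"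
            using hE elim(6) e \<open>L > 0\<close> K1 E(1)[OF n e1]
            by (intro add_mono divide_right_mono mult_left_mono power_mono) auto
          also have "\<dots> = K3 * E n * (r n)\<^sup>2" by (simp add: K3_def algebra_simps)
          also have "\<dots> \<le> K3 * E n * (d / sqrt K3 * (real n powr c0 * \<epsilon> n))\<^sup>2"
            using elim(5) r K3 E(1)[OF n e1] by (intro mult_left_mono power_mono) auto
          also have "\<dots> = (d * real n powr c0)\<^sup>2 * (E n * (\<epsilon> n)\<^sup>2)"
            using K3 by (simp add: power_mult_distrib power_divide)
          also have "\<dots> = (d * (real n powr c0 * \<epsilon> n powr (2 * \<xi> / (2 * \<xi> + 1))))\<^sup>2"
            unfolding E(2)[OF n e1] by (simp add: power_mult_distrib)
          finally have "l2_norm P (\<lambda>w. \<alpha>_hat n \<omega> (X w) - \<alpha>_bar (X w))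
              \<le> d * (real n powr c0 * \<epsilon> n powr (2 * \<xi> / (2 * \<xi> + 1)))"
            unfolding l2_norm_def using \<open>d > 0\<close> by (intro real_le_lsqrt) auto
          moreover have "l2_norm P (\<lambda>w. \<alpha>_hat n \<omega> (X w) - \<alpha>_bar (X w)) \<ge> 0"
            by (simp add: l2_norm_def)
          ultimately show False using bad by simp
        qed
        then have "prob (?bad n) \<le> prob (?A \<union> ?G \<union> (space \<Omega> - ?R n))"
          by (rule finite_measure_mono) (intro sets.Un sets.Diff sets.top A_sets G_sets R_sets)
        also have "\<dots> \<le> prob (?A \<union> ?G) + prob (space \<Omega> - ?R n)"
          by (rule measure_Un_le) (intro sets.Un sets.Diff sets.top A_sets G_sets R_sets)+
        also have "prob (?A \<union> ?G) \<le> prob ?A + prob ?G"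
          by (rule measure_Un_le[OF A_sets G_sets])
        also have "prob (space \<Omega> - ?R n) = 1 - prob (?R n)" by (rule prob_compl[OF R_sets])
        finally have "prob (?bad n) \<le> prob ?A + prob ?G + (1 - prob (?R n))" by simp
        moreover have "prob ?G \<le> \<eta> / 4"
          using BE[OF n p_ge[OF n] g gV[OF n e1]] .
        ultimately show "prob (?bad n) < \<eta>" using elim(1,3) \<open>\<eta> > 0\<close> by linarith
      qed
    qed
    note small = this
    show "(\<lambda>n. prob (?bad n)) \<longlonglongrightarrow> 0"
    proof (rule order_tendstoI)
      fix t :: real
      assume "t < 0"
      then show "\<forall>\<^sub>F n in sequentially. t < prob (?bad n)"
        by (intro always_eventually allI) (rule less_le_trans[OF _ measure_nonneg])
    qed (rule small)
  qed
qed

end
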